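(* Let $\mathbf Z=(\mathbf Y,\mathbf X)$ be an ergodic unreliable Jackson network process with stationary distribution $\tilde\pi$, let $\xi^D$ be, for each $D\subseteq\tilde J$, the probability solution of $x=x\cdot R^D$ specified in the context, and let $f,g\in L^2(\tilde{\mathbb E},\tilde\pi)$ be real functions. Then $$\langle f,Q^{\mathbf Z}g\rangle_{\tilde\pi}=\sum_{D\subseteq\tilde J}\sum_{n\in\mathbb N^J}\tilde\pi(D,n)\Big\{\sum_{H\subset D}q^{\mathbf Y}(D,H)f(D,n)g(H,n)+\sum_{I\supset D}q^{\mathbf Y}(D,I)f(D,n)g(I,n)\Big\}$$ $$+\sum_{D\subseteq\tilde J}\sum_{n\in\mathbb N^J}\tilde\pi(D,n)\frac{\lambda}{\xi^D_0}\Big\{\sum_{j\in\tilde J_0\setminus D}\ \sum_{i\in\tilde J_0\setminus D}\xi^D_jr^D_{ji}f(D,n+e_j)g(D,n+e_i)\Big\}$$ $$-\sum_{D\subseteq\tilde J}\sum_{n\in\mathbb N^J}\tilde\pi(D,n)f(D,n)g(D,n)\Big\{\sum_{H\subset D}q^{\mathbf Y}(D,H)+\sum_{I\supset D}q^{\mathbf Y}(D,I)+\lambda+\sum_{j\in\tilde J\setminus D}\mu_j(n_j)\Big\}.$$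
   Context: Notation: $\mathbb N=\{0,1,2,\dots\}$, $\tilde J=\{1,\dots,J\}$, $\tilde J_0=\{0,1,\dots,J\}$; $\subset$ denotes strict inclusion; $e_j$ is the $j$-th standard base vector of $\mathbb N^J$ ($1\le j\le J$) and $e_0=0$. $\langle f,g\rangle_{\nu}=\int fg\,d\nu$. Network data: an arrival intensity $\lambda>0$; an irreducible stochastic routing matrix $R=[r_{ij}]_{i,j\in\tilde J_0}$ ($r_{00}\ge 0$ allowed; node $0$ is source and sink); service rates $\mu_j(k)>0$ for $k\ge1$, $\mu_j(0)=0$, with $\sup_{j,k}\mu_j(k)<\infty$. The traffic equations $\eta_j=\lambda r_{0j}+\sum_{i=1}^J\eta_ir_{ij}$, $j\in\tilde J$, have a unique solution $(\eta_j)_{j\in\tilde J}$; put $\eta_0=\lambda$. The network (without breakdowns) is assumed ergodic, i.e. $C_j:=\sum_{m\ge0}\prod_{k=1}^{m}\eta_j/\mu_j(k)<\infty$ for all $j$, and $\pi(n)=\prod_{j=1}^J C_j^{-1}\prod_{k=1}^{n_j}\frac{\eta_j}{\mu_j(k)}$ on $\mathbb N^J$. Breakdown and repair: functions $A,B:2^{\tilde J}\to[0,\infty)$ with $A(\emptyset)=B(\emptyset)=1$, $A(I)/A(D)<\infty$ for all $D\subset I\subseteq\tilde J$ and $B(D)/B(H)<\infty$ for all $H\subset D\subseteq\tilde J$ (conventions $0/0=0$, $1/0=\infty$). $\mathbf Y$ is the Markov process on $2^{\tilde J}$ (its state is the set of broken down nodes) with rates $q^{\mathbf Y}(D,I)=A(I)/A(D)$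 for $D\subset I$, $q^{\mathbf Y}(D,H)=B(D)/B(H)$ for $H\subset D$, other off-diagonal rates zero, and generator $(Q^{\mathbf Y}h)(D)=\sum_{H\subset D}q^{\mathbf Y}(D,H)(h(H)-h(D))+\sum_{I\supset D}q^{\mathbf Y}(D,I)(h(I)-h(D))$. It is reversible with respect to the probability $\hat\pi(D)=\hat C^{-1}A(D)/B(D)$. Rerouting assumption: for each $D\subseteq\tilde J$ there is a stochastic matrix $R^D=[r^D_{ij}]_{i,j\in\tilde J_0\setminus D}$, $R^\emptyset=R$, such that $\eta_j=\lambda r^D_{0j}+\sum_{i\in\tilde J\setminus D}\eta_ir^D_{ij}$ for all $j\in\tilde J\setminus D$ (same $\eta$ for every $D$). Then $(\eta_j)_{j\in\tilde J_0\setminus D}$ solves $x=x\cdot R^D$, and $\xi^D=(\xi^D_j)_{j\in\tilde J_0\setminus D}$ denotes its normalization to a probability vector, $\xi^D_j=\eta_j/\sum_{k\in\tilde J_0\setminus D}\eta_k$. Unreliable Jackson network process $\mathbf Z=(\mathbf Y,\mathbf X)$: the Markov process on $\tilde{\mathbb E}=2^{\tilde J}\times\mathbb N^J$ with generator $(Q^{\mathbf Z}f)(D,n)=\sum_{j\in\tilde J\setminus D}\lambda r^D_{0j}(f(D,n+e_j)-f(D,n))+\sum_{j\in\tilde J\setminus D}\mu_j(n_j)r^D_{j0}(f(D,n-e_j)-f(D,n))+\sum_{j\in\tilde J\setminus D}\mu_j(n_j)\sum_{i\in\tilde J\setminus D}r^D_{ji}(f(D,n-e_j+e_i)-f(D,n))+(Q^{\mathbf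 Y}f(\cdot,n))(D)$. Terms with factor $\mu_j(0)$ are zero. If $\mathbf Z$ is ergodic, its unique stationary distribution is known to be $\tilde\pi(D,n)=\hat\pi(D)\pi(n)$. *)

theory Defs
  imports "HOL-Probability.Probability" "HOL-Library.Function_Algebras"
begin

text \<open>
  The nodes \<open>1, \<dots>, J\<close> are the elements of a finite type \<open>'j\<close>. The nodes together with the
  source/sink \<open>0\<close> are the elements of \<open>'j option\<close>, with \<open>None\<close> playing the role of \<open>0\<close>.
  A state \<open>(D, n)\<close> of the network consists of the set \<open>D\<close> of broken down nodes and the vector \<open>n\<close>
  of queue lengths.
\<close>

type_synonym 'j state = "'j set \<times> ('j \<Rightarrow> nat)"

text \<open>The base vectors, with \<open>e None = 0\<close>; sums and differences of vectors are pointwise.\<close>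

definition e :: "'j option \<Rightarrow> 'j \<Rightarrow> nat" where
  "e j = (\<lambda>i. if j = Some i then 1 else 0)"

text \<open>The set \<open>{0, 1, \<dots>, J} - D\<close>.\<close>

definition nodes0 :: "'j set \<Rightarrow> 'j option set" where
  "nodes0 D = insert None (Some ` (- D))"


section \<open>Markov semigroups on discrete state spaces\<close>

text \<open>
  A Markov process is given by its transition function: \<open>P t x\<close> is the law at time \<open>t\<close> of the
  process started in \<open>x\<close>. Only times \<open>t \<ge> 0\<close> are constrained.
\<close>

definition transition_semigroup :: "(real \<Rightarrow> 'a \<Rightarrow> 'a pmf) \<Rightarrow> bool" where
  "transition_semigroup P \<longleftrightarrow>
     (\<forall>x. P 0 x = return_pmf x) \<and>
     (\<forall>s\<ge>0. \<forall>t\<ge>0. \<forall>x. P (s + t) x = bind_pmf (P s x) (P t))"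

text \<open>
  All bounded functions are required to be in the domain of the generator; this is appropriate
  for processes with bounded jump rates, such as the ones considered here.
\<close>

definition has_generator ::
  "(real \<Rightarrow> 'a \<Rightarrow> 'a pmf) \<Rightarrow> (('a \<Rightarrow> real) \<Rightarrow> 'a \<Rightarrow> real) \<Rightarrow> bool" where
  "has_generator P Q \<longleftrightarrow>
     (\<forall>f x. bounded (range f) \<longrightarrow>
        ((\<lambda>t. (measure_pmf.expectation (P t x) f - f x) / t) \<longlongrightarrow> Q f x) (at_right 0))"

definition stationary_distribution :: "(real \<Rightarrow> 'a \<Rightarrow> 'a pmf) \<Rightarrow> 'a pmf \<Rightarrow> bool" where
  "stationary_distribution P p \<longleftrightarrow> (\<forall>t\<ge>0. bind_pmf p (P t) = p)"

text \<open>
  Irreducibility is not demanded, so that transient states are permitted: the functions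
  \<open>A\<close> below may vanish, which makes the states \<open>(D, n)\<close> with \<open>A D = 0\<close> transient. An irreducible
  positive recurrent process is ergodic in this sense.
\<close>

definition ergodic :: "(real \<Rightarrow> 'a \<Rightarrow> 'a pmf) \<Rightarrow> bool" where
  "ergodic P \<longleftrightarrow>
     (\<exists>p. stationary_distribution P p \<and>
        (\<forall>x y. ((\<lambda>t. pmf (P t x) y) \<longlongrightarrow> pmf p y) at_top))"

definition square_integrable :: "'a pmf \<Rightarrow> ('a \<Rightarrow> real) \<Rightarrow> bool" where
  "square_integrable p f \<longleftrightarrow> integrable (measure_pmf p) (\<lambda>x. (f x)\<^sup>2)"

definition inner_prod :: "'a pmf \<Rightarrow> ('a \<Rightarrow> real) \<Rightarrow> ('a \<Rightarrow> real) \<Rightarrow> real" where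
  "inner_prod p f g = (\<integral>x. f x * g x \<partial>measure_pmf p)"


section \<open>Unreliable Jackson networks\<close>

definition stochastic_on :: "'a set \<Rightarrow> ('a \<Rightarrow> 'a \<Rightarrow> real) \<Rightarrow> bool" where
  "stochastic_on S r \<longleftrightarrow> (\<forall>i\<in>S. \<forall>j\<in>S. 0 \<le> r i j) \<and> (\<forall>i\<in>S. (\<Sum>j\<in>S. r i j) = 1)"

definition irreducible_matrix :: "('a \<Rightarrow> 'a \<Rightarrow> real) \<Rightarrow> bool" where
  "irreducible_matrix r \<longleftrightarrow> (\<forall>i j. (i, j) \<in> {(k, l). 0 < r k l}\<^sup>*)"

text \<open>
  The quotients in \<open>A_finite\<close> and \<open>B_finite\<close> are taken in \<open>ennreal\<close>, where \<open>0 / 0 = 0\<close> and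
  \<open>c / 0 = \<infinity>\<close> for \<open>c > 0\<close>. Where they are finite, they agree with real division.
  Only the entries of \<open>RD D\<close> with both indices in \<open>nodes0 D\<close> are meaningful.
\<close>

locale unreliable_jackson_network =
  fixes lam :: real
    and R :: "'j::finite option \<Rightarrow> 'j option \<Rightarrow> real"
    and mu :: "'j \<Rightarrow> nat \<Rightarrow> real"
    and eta :: "'j \<Rightarrow> real"
    and A B :: "'j set \<Rightarrow> real"
    and RD :: "'j set \<Rightarrow> 'j option \<Rightarrow> 'j option \<Rightarrow> real"
  assumes lam_pos: "0 < lam"
    and R_stochastic: "stochastic_on UNIV R"
    and R_irreducible: "irreducible_matrix R"
    and mu_0: "\<And>j. mu j 0 = 0"
    and mu_pos: "\<And>j k. 1 \<le> k \<Longrightarrow> 0 < mu j k"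
    and mu_bounded: "bdd_above (range (\<lambda>(j, k). mu j k))"
    and traffic: "\<And>j. eta j = lam * R None (Some j) + (\<Sum>i\<in>UNIV. eta i * R (Some i) (Some j))"
    and network_ergodic: "\<And>j. summable (\<lambda>m. \<Prod>k=1..m. eta j / mu j k)"
    and A_nonneg: "\<And>D. 0 \<le> A D"
    and B_nonneg: "\<And>D. 0 \<le> B D"
    and A_empty: "A {} = 1"
    and B_empty: "B {} = 1"
    and A_finite: "\<And>D I. D \<subset> I \<Longrightarrow> ennreal (A I) / ennreal (A D) < \<infinity>"
    and B_finite: "\<And>H D. H \<subset> D \<Longrightarrow> ennreal (B D) / ennreal (B H) < \<infinity>"
    and RD_stochastic: "\<And>D. stochastic_on (nodes0 D) (RD D)"
    and RD_empty: "RD {} = R"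
    and RD_traffic: "\<And>D j. j \<notin> D \<Longrightarrow>
          eta j = lam * RD D None (Some j) + (\<Sum>i\<in>- D. eta i * RD D (Some i) (Some j))"

definition eta0 :: "real \<Rightarrow> ('j \<Rightarrow> real) \<Rightarrow> 'j option \<Rightarrow> real" where
  "eta0 lam eta j = (case j of None \<Rightarrow> lam | Some i \<Rightarrow> eta i)"

definition xi :: "real \<Rightarrow> ('j::finite \<Rightarrow> real) \<Rightarrow> 'j set \<Rightarrow> 'j option \<Rightarrow> real" where
  "xi lam eta D j = eta0 lam eta j / (\<Sum>k\<in>nodes0 D. eta0 lam eta k)"

definition qY :: "('j set \<Rightarrow> real) \<Rightarrow> ('j set \<Rightarrow> real) \<Rightarrow> 'j set \<Rightarrow> 'j set \<Rightarrow> real" where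
  "qY A B D I = (if D \<subset> I then A I / A D else if I \<subset> D then B D / B I else 0)"

definition QY ::
  "('j::finite set \<Rightarrow> real) \<Rightarrow> ('j set \<Rightarrow> real) \<Rightarrow> ('j set \<Rightarrow> real) \<Rightarrow> 'j set \<Rightarrow> real" where
  "QY A B h D =
     (\<Sum>H | H \<subset> D. qY A B D H * (h H - h D)) + (\<Sum>I | D \<subset> I. qY A B D I * (h I - h D))"

text \<open>Truncated subtraction in \<open>n - e (Some j)\<close> is harmless, since \<open>mu j 0 = 0\<close>.\<close>

definition QZ ::
  "real \<Rightarrow> ('j::finite \<Rightarrow> nat \<Rightarrow> real) \<Rightarrow> ('j set \<Rightarrow> real) \<Rightarrow> ('j set \<Rightarrow> real) \<Rightarrow>
   ('j set \<Rightarrow> 'j option \<Rightarrow> 'j option \<Rightarrow> real) \<Rightarrow> ('j state \<Rightarrow> real) \<Rightarrow> 'j state \<Rightarrow> real" where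
  "QZ lam mu A B RD f = (\<lambda>(D, n).
     (\<Sum>j\<in>- D. lam * RD D None (Some j) * (f (D, n + e (Some j)) - f (D, n)))
   + (\<Sum>j\<in>- D. mu j (n j) * RD D (Some j) None * (f (D, n - e (Some j)) - f (D, n)))
   + (\<Sum>j\<in>- D. mu j (n j) *
        (\<Sum>i\<in>- D. RD D (Some j) (Some i) * (f (D, n - e (Some j) + e (Some i)) - f (D, n))))
   + QY A B (\<lambda>D'. f (D', n)) D)"

text \<open>
  \<open>P\<close> is the transition function of the process \<open>Z = (Y, X)\<close>.
\<close>

definition unreliable_jackson_process ::
  "real \<Rightarrow> ('j::finite \<Rightarrow> nat \<Rightarrow> real) \<Rightarrow> ('j set \<Rightarrow> real) \<Rightarrow> ('j set \<Rightarrow> real) \<Rightarrow>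
   ('j set \<Rightarrow> 'j option \<Rightarrow> 'j option \<Rightarrow> real) \<Rightarrow> (real \<Rightarrow> 'j state \<Rightarrow> 'j state pmf) \<Rightarrow> bool" where
  "unreliable_jackson_process lam mu A B RD P \<longleftrightarrow>
     transition_semigroup P \<and> has_generator P (QZ lam mu A B RD)"

end

theory Submission
  imports Defs
begin

text \<open>
  Suppose first that \<open>p\<close> is the product form \<open>p (D, n) = \<pi>\<^sub>Y D * \<pi> n\<close>. Write the generator as
  a sum of gain terms minus \<open>g (D, n)\<close> times the total exit rate (\<open>QZ_jump_form\<close>). Multiplied by \<open>f\<close>
  and integrated, the breakdown and exit terms already have the claimed shape. A
  routing term is \<open>f (D, n) * g (D, n - e j + e i)\<close> times the rate at which customers leave \<open>j\<close>,
  and the substitution \<open>n \<mapsto> n + e j\<close> gives the claimed shape to it, because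
  \<open>\<pi> (n + e j) * mu j (n j + 1) = \<pi> n * eta j\<close> (\<open>queues_balance\<close>, \<open>queues_shift\<close>). The network
  rates are bounded and \<open>\<pi>\<^sub>Y\<close> satisfies detailed balance, so shifted arguments do not spoil square
  integrability, and by the Cauchy-Schwarz inequality all sums converge
  (\<open>integral_over_queues\<close>, \<open>inner_prod_formula\<close>).

  That \<open>p\<close> is the product form is derived from the process. The formula with \<open>f = 1\<close>
  shows that the generator of every bounded function has integral \<open>0\<close> under the product form
  (\<open>product_form_generator_zero\<close>). As the jump rates are bounded, the semigroup is Lipschitz in
  time uniformly in the initial state, so integrals of bounded functions can be differentiated
  under the integral sign, and the product form is stationary (\<open>stationary_if_generator_integral_zero\<close>).
  In an ergodic process there is only one stationary distribution (\<open>ergodic_stationary_unique\<close>).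

  Two positivity facts make the product form well defined. The solution \<open>eta\<close> of the traffic equations
  is positive, since the routing matrix is irreducible (\<open>invariant_vector_pos\<close>). And \<open>B\<close> never vanishes:
  if \<open>B D = 0\<close>, the nodes in \<open>D\<close> cannot be repaired once all of \<open>D\<close> is broken down, their queues are frozen
  at the initial lengths, and the process is not ergodic (\<open>ergodic_imp_B_pos\<close>).
\<close>


section \<open>Transition semigroups with bounded jump rates\<close>

text \<open>
  Dominated convergence concerns sequences, hence increments are controlled only along some sequence
  of step sizes that depends on the time. The set of times up to which
  the path has lost at most \<open>eps\<close> per unit of time is closed, and no time before \<open>T\<close> can be
  its supremum.
\<close>

lemma nondecreasing_of_right_increments:
  fixes G :: "real \<Rightarrow> real"
  assumes cont: "continuous_on {0..} G"
    and step: "\<And>t eps. t \<ge> 0 \<Longrightarrow> eps > 0 \<Longrightarrow>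
      (\<exists>h. h \<longlonglongrightarrow> 0 \<and> (\<forall>n. h n > (0::real)) \<and> (\<forall>\<^sub>F n in sequentially. G (t + h n) \<ge> G t - eps * h n))"
    and "T \<ge> 0"
  shows "G T \<ge> G 0"
proof (rule field_le_epsilon)
  fix d :: real assume "d > 0"
  define eps where "eps = d / (T + 1)"
  have eps: "eps > 0" using \<open>d > 0\<close> \<open>T \<ge> 0\<close> by (simp add: eps_def)
  define S where "S = {s \<in> {0..T}. G 0 - eps * s \<le> G s}"
  have "closed S" unfolding S_def
    by (intro continuous_on_closed_Collect_le continuous_intros continuous_on_subset[OF cont]) auto
  have "0 \<in> S" using \<open>T \<ge> 0\<close> by (simp add: S_def)
  have bdd: "bdd_above S" by (rule bdd_aboveI[of _ T]) (simp add: S_def)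
  define s where "s = Sup S"
  have sS: "s \<in> S" unfolding s_def
    by (rule closed_contains_Sup) (use \<open>0 \<in> S\<close> bdd \<open>closed S\<close> in auto)
  have "s = T"
  proof (rule ccontr)
    assume "s \<noteq> T"
    hence "s < T" "s \<ge> 0" using sS by (auto simp: S_def)
    obtain h where h: "h \<longlonglongrightarrow> 0" "\<And>n. h n > 0"
      and inc: "\<forall>\<^sub>F n in sequentially. G (s + h n) \<ge> G s - eps * h n"
      using step[OF \<open>s \<ge> 0\<close> eps] by blast
    have "\<forall>\<^sub>F n in sequentially. h n < T - s"
      using h(1) \<open>s < T\<close> by (intro order_tendstoD) auto
    with inc have "\<forall>\<^sub>F n in sequentially. s + h n \<in> S"
    proof eventually_elim
      case (elim n)
      thus ?case using sS h(2)[of n] \<open>s \<ge> 0\<close> by (auto simp: S_def algebra_simps)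
    qed
    then obtain n where "s + h n \<in> S" by (auto simp: eventually_sequentially)
    from cSup_upper[OF this bdd] show False using h(2)[of n] by (simp add: s_def)
  qed
  hence "G 0 \<le> G T + eps * T" using sS by (simp add: S_def)
  also have "eps * T \<le> d"
    using \<open>d > 0\<close> \<open>T \<ge> 0\<close> by (simp add: eps_def field_simps)
  finally show "G 0 \<le> G T + d" by simp
qed

lemma integrable_pmf_bounded:
  fixes f :: "'a \<Rightarrow> real"
  assumes "\<And>x. \<bar>f x\<bar> \<le> c"
  shows "integrable (measure_pmf m) f"
  by (rule measure_pmf.integrable_const_bound[of _ c]) (use assms in auto)

lemma expectation_bounded:
  fixes f :: "'a \<Rightarrow> real"
  assumes "\<And>x. \<bar>f x\<bar> \<le> c"
  shows "\<bar>measure_pmf.expectation m f\<bar> \<le> c"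
proof -
  have "\<bar>measure_pmf.expectation m f\<bar> \<le> measure_pmf.expectation m (\<lambda>x. \<bar>f x\<bar>)"
    by (rule integral_abs_bound)
  also have "\<dots> \<le> measure_pmf.expectation m (\<lambda>x. c)"
    using assms by (intro integral_mono integrable_pmf_bounded[where c = c]) (auto intro: order_trans[OF abs_ge_zero])
  finally show ?thesis by simp
qed

lemma expectation_bind_pmf:
  fixes f :: "'a \<Rightarrow> real"
  assumes "\<And>x. \<bar>f x\<bar> \<le> c"
  shows "measure_pmf.expectation (bind_pmf m N) f = measure_pmf.expectation m (\<lambda>x. measure_pmf.expectation (N x) f)"
  unfolding measure_pmf_bind using measurable_measure_pmf[of N] assms
  by (intro integral_bind[where K = "count_space UNIV" and B = c and B' = 1])
     (auto simp: measure_pmf.emeasure_space_1[simplified] intro: measure_pmf.finite_measure_axioms)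

lemma pmf_eqI_expectation:
  assumes "\<And>u :: 'a \<Rightarrow> real. (\<And>x. \<bar>u x\<bar> \<le> 1) \<Longrightarrow>
     measure_pmf.expectation p u = measure_pmf.expectation q u"
  shows "p = q"
proof (rule pmf_eqI)
  fix i
  show "pmf p i = pmf q i"
    using assms[of "indicator {i}"] by (simp add: indicator_def pmf.rep_eq)
qed

text \<open>
  The number \<open>- Q (indicator {x}) x\<close> is the total rate of the jumps out of \<open>x\<close>.
\<close>

locale bounded_generator =
  fixes P :: "real \<Rightarrow> 'a \<Rightarrow> 'a pmf" and Q :: "('a \<Rightarrow> real) \<Rightarrow> 'a \<Rightarrow> real" and K :: real
  assumes semigroup: "transition_semigroup P"
    and generator: "has_generator P Q"
    and rate_nonneg: "0 \<le> K"
    and rate_bound: "\<And>x. - K \<le> Q (indicator {x}) x"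
begin

lemma generator_tendsto:
  assumes "\<And>x. \<bar>f x\<bar> \<le> c"
  shows "((\<lambda>t. (measure_pmf.expectation (P t x) f - f x) / t) \<longlongrightarrow> Q f x) (at_right 0)"
proof -
  have "bounded (range f)" using assms by (auto simp: bounded_iff)
  thus ?thesis using generator by (auto simp: has_generator_def)
qed

lemma Chapman_Kolmogorov: "s \<ge> 0 \<Longrightarrow> t \<ge> 0 \<Longrightarrow> P (s + t) x = bind_pmf (P s x) (P t)"
  using semigroup by (auto simp: transition_semigroup_def)

lemma P_0: "P 0 x = return_pmf x"
  using semigroup by (auto simp: transition_semigroup_def)

text \<open>
  One way of being in \<open>x\<close> at time \<open>s + t\<close> is to be there at time \<open>s\<close> as well.
\<close>

lemma pmf_holding_mult:
  assumes "s \<ge> 0" "t \<ge> 0"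
  shows "pmf (P s x) x * pmf (P t x) x \<le> pmf (P (s + t) x) x"
proof -
  have "pmf (P s x) x * pmf (P t x) x = measure_pmf.expectation (P s x) (\<lambda>y. indicator {x} y * pmf (P t x) x)"
    by (simp add: pmf.rep_eq)
  also have "\<dots> \<le> measure_pmf.expectation (P s x) (\<lambda>y. pmf (P t y) x)"
    by (intro integral_mono integrable_pmf_bounded[where c = 1])
       (auto simp: indicator_def pmf_le_1)
  also have "\<dots> = pmf (P (s + t) x) x"
    using assms by (simp add: Chapman_Kolmogorov pmf_bind)
  finally show ?thesis .
qed

lemma pmf_holding_power:
  assumes "h \<ge> 0"
  shows "pmf (P h x) x ^ n \<le> pmf (P (real n * h) x) x"
proof (induction n)
  case (Suc n)
  have "pmf (P h x) x ^ Suc n \<le> pmf (P h x) x * pmf (P (real n * h) x) x"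
    using Suc by (simp add: mult_left_mono)
  also have "\<dots> \<le> pmf (P (h + real n * h) x) x"
    using assms by (intro pmf_holding_mult) auto
  finally show ?case by (simp add: algebra_simps)
qed (simp add: P_0)

text \<open>
  The generator bounds the probability of having left \<open>x\<close> only to first order at \<open>0\<close>, and not
  uniformly in \<open>x\<close>. Cutting \<open>[0, t]\<close> into many short pieces and staying in \<open>x\<close> at all
  division points turns this into a bound that holds for all times and is uniform in \<open>x\<close>.
\<close>

lemma pmf_holding_ge:
  assumes "t \<ge> 0"
  shows "1 - K * t \<le> pmf (P t x) x"
proof (cases "t = 0")
  case False
  hence t: "t > 0" using assms by simp
  show ?thesis
  proof (rule field_le_epsilon)
    fix d :: real assume "d > 0"
    \<comment> \<open>The slack \<open>d / t\<close> in the rate costs \<open>d\<close> over the whole interval; the size of \<open>n\<close> also ensures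
      \<open>L * t / n \<le> 1\<close>, as Bernoulli's inequality requires.\<close>
    define L where "L = K + d / t"
    have L: "L > K" using \<open>d > 0\<close> t by (simp add: L_def)
    have "((\<lambda>h. (pmf (P h x) x - 1) / h) \<longlongrightarrow> Q (indicator {x}) x) (at_right 0)"
      using generator_tendsto[of "indicator {x}" 1 x] by (simp add: indicator_def pmf.rep_eq)
    hence "\<forall>\<^sub>F h in at_right 0. - L < (pmf (P h x) x - 1) / h"
      using L rate_bound[of x] by (intro order_tendstoD) auto
    then obtain r where r: "r > 0" and hold: "\<And>h. 0 < h \<Longrightarrow> h < r \<Longrightarrow> - L < (pmf (P h x) x - 1) / h"
      by (auto simp: eventually_at_right_field)
    obtain n :: nat where n: "max (t / r) (L * t) < n" using reals_Archimedean2 by blast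
    have n0: "real n > 0" using n t r by (smt (verit) divide_pos_pos)
    define h where "h = t / n"
    have h: "0 < h" "h < r" "L * h \<le> 1" "real n * h = t"
      using n n0 t r by (auto simp: h_def field_simps)
    have "1 - L * t = 1 + real n * (- (L * h))" using h(4) by (simp add: algebra_simps)
    also have "\<dots> \<le> (1 - L * h) ^ n"
      using Bernoulli_inequality[of "- (L * h)" n] h by simp
    also have "\<dots> \<le> pmf (P h x) x ^ n"
      using hold[of h] h by (intro power_mono) (auto simp: field_simps)
    also have "\<dots> \<le> pmf (P t x) x"
      using pmf_holding_power[of h x n] h by simp
    finally show "1 - K * t \<le> pmf (P t x) x + d"
      using t by (simp add: L_def algebra_simps)
  qed
qed (simp add: P_0)

text \<open>
  The value of \<open>f\<close> changes only if \<open>x\<close> has been left. The bound is uniform in \<open>x\<close>, and so it dominates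
  the difference quotients when the generator is integrated against an arbitrary initial law.
\<close>

lemma semigroup_increment_le:
  assumes f: "\<And>x. \<bar>f x\<bar> \<le> c" and "h \<ge> 0"
  shows "\<bar>measure_pmf.expectation (P h x) f - f x\<bar> \<le> 2 * c * K * h"
proof -
  have c: "c \<ge> 0" using f[of x] by linarith
  have [simp]: "integrable (measure_pmf m) f" for m using f by (rule integrable_pmf_bounded)
  have bd: "\<bar>f y - f x\<bar> \<le> 2 * c * (1 - indicator {x} y)" for y
    using f[of x] f[of y] by (auto simp: indicator_def)
  have jump: "measure_pmf.expectation (P h x) (\<lambda>y. 1 - indicator {x} y) = 1 - pmf (P h x) x"
    by (subst Bochner_Integration.integral_diff)
       (auto intro!: integrable_pmf_bounded[where c = 1] simp: pmf.rep_eq indicator_def)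
  have "\<bar>measure_pmf.expectation (P h x) f - f x\<bar> = \<bar>measure_pmf.expectation (P h x) (\<lambda>y. f y - f x)\<bar>"
    by simp
  also have "\<dots> \<le> measure_pmf.expectation (P h x) (\<lambda>y. \<bar>f y - f x\<bar>)"
    by (rule integral_abs_bound)
  also have "\<dots> \<le> measure_pmf.expectation (P h x) (\<lambda>y. 2 * c * (1 - indicator {x} y))"
    using bd by (intro integral_mono integrable_mult_right integrable_abs Bochner_Integration.integrable_diff
          integrable_pmf_bounded[where f = "\<lambda>y. 1 - indicator {x} y" and c = 1]) (auto simp: indicator_def)
  also have "\<dots> = 2 * c * (1 - pmf (P h x) x)"
    using jump by simp
  also have "\<dots> \<le> 2 * c * (K * h)"
    using pmf_holding_ge[OF assms(2), of x] c by (intro mult_left_mono) auto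
  finally show ?thesis by (simp add: mult.assoc)
qed

lemma increment_quotient_tendsto:
  assumes f: "\<And>x. \<bar>f x\<bar> \<le> c" and h: "h \<longlonglongrightarrow> 0" "\<And>n. h n > 0"
  shows "(\<lambda>n. (measure_pmf.expectation m (\<lambda>x. measure_pmf.expectation (P (h n) x) f)
            - measure_pmf.expectation m f) / h n) \<longlonglongrightarrow> measure_pmf.expectation m (Q f)"
proof -
  have [simp]: "integrable (measure_pmf m) f" for m using f by (rule integrable_pmf_bounded)
  have [simp]: "integrable (measure_pmf m) (\<lambda>x. measure_pmf.expectation (P t x) f)" for m t
    using f by (intro integrable_pmf_bounded[where c = c] expectation_bounded)
  have at: "filterlim h (at_right 0) sequentially"
    using h by (auto simp: filterlim_at less_imp_neq[symmetric])
  have "(\<lambda>n. measure_pmf.expectation m (\<lambda>x. (measure_pmf.expectation (P (h n) x) f - f x) / h n))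
          \<longlonglongrightarrow> measure_pmf.expectation m (Q f)"
  proof (rule integral_dominated_convergence[where w = "\<lambda>_. 2 * c * K"])
    show "AE x in measure_pmf m. (\<lambda>n. (measure_pmf.expectation (P (h n) x) f - f x) / h n) \<longlonglongrightarrow> Q f x"
      using filterlim_compose[OF generator_tendsto[of f c, OF f] at] by simp
    show "AE x in measure_pmf m. norm ((measure_pmf.expectation (P (h n) x) f - f x) / h n) \<le> 2 * c * K" for n
      using semigroup_increment_le[of f c "h n", OF f] h(2)[of n] by (auto simp: field_simps)
  qed auto
  thus ?thesis by simp
qed

text \<open>
  The path \<open>G\<close> is the integral of \<open>v t\<close> against \<open>m t\<close>, and letting time run for \<open>h\<close> more units
  inserts \<open>P h\<close> between the two. With \<open>m\<close> constant and \<open>v t\<close> the image of a function under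
  \<open>P t\<close>, the hypothesis on the drift is a statement about Kolmogorov's backward equation; with \<open>v\<close> constant and
  \<open>m t\<close> the law at time \<open>t\<close>, about the forward equation. Both forms are needed.
\<close>

lemma nondecreasing_along_semigroup:
  fixes G :: "real \<Rightarrow> real" and m :: "real \<Rightarrow> 'a pmf" and v :: "real \<Rightarrow> 'a \<Rightarrow> real"
  assumes v: "\<And>t x. t \<ge> 0 \<Longrightarrow> \<bar>v t x\<bar> \<le> c"
    and G: "\<And>t. t \<ge> 0 \<Longrightarrow> G t = measure_pmf.expectation (m t) (v t)"
    and Gh: "\<And>t h. t \<ge> 0 \<Longrightarrow> h \<ge> 0 \<Longrightarrow>
      G (t + h) = measure_pmf.expectation (m t) (\<lambda>x. measure_pmf.expectation (P h x) (v t))"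
    and drift: "\<And>t. t \<ge> 0 \<Longrightarrow> 0 \<le> measure_pmf.expectation (m t) (Q (v t))"
    and "T \<ge> 0"
  shows "G 0 \<le> G T"
proof -
  have c: "c \<ge> 0" using v[of 0 undefined] by simp
  have inc: "\<bar>G (t + h) - G t\<bar> \<le> 2 * c * K * h" if "t \<ge> 0" "h \<ge> 0" for t h
  proof -
    have "G (t + h) - G t = measure_pmf.expectation (m t) (\<lambda>x. measure_pmf.expectation (P h x) (v t) - v t x)"
      unfolding Gh[OF that] G[OF that(1)]
      by (rule Bochner_Integration.integral_diff[symmetric])
         (auto intro!: integrable_pmf_bounded[where c = c] expectation_bounded v that)
    thus ?thesis
      using expectation_bounded[OF semigroup_increment_le[OF v[OF that(1)] that(2)]] by simp
  qed
  have lip: "\<bar>G y - G x\<bar> \<le> 2 * c * K * \<bar>y - x\<bar>" if "x \<ge> 0" "y \<ge> 0" for x y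
    using inc[of x "y - x"] inc[of y "x - y"] that by (cases "x \<le> y") (auto simp: abs_minus_commute)
  have "(2 * c * K)-lipschitz_on {0..} G"
    using lip c rate_nonneg by (intro lipschitz_onI) (auto simp: dist_real_def)
  hence cont: "continuous_on {0..} G" by (rule lipschitz_on_continuous_on)
  show ?thesis
  proof (rule nondecreasing_of_right_increments[OF cont _ \<open>T \<ge> 0\<close>])
    fix t eps :: real assume t: "t \<ge> 0" and "eps > 0"
    define h :: "nat \<Rightarrow> real" where "h n = 1 / real (Suc n)" for n
    have h: "h \<longlonglongrightarrow> 0" "\<And>n. h n > 0"
      unfolding h_def using LIMSEQ_inverse_real_of_nat by (auto simp: inverse_eq_divide)
    have "(\<lambda>n. (G (t + h n) - G t) / h n) \<longlonglongrightarrow> measure_pmf.expectation (m t) (Q (v t))"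
      using increment_quotient_tendsto[OF v[OF t] h, of "m t"] h(2)
      by (simp add: G[OF t] Gh[OF t less_imp_le])
    hence "\<forall>\<^sub>F n in sequentially. - eps < (G (t + h n) - G t) / h n"
      using drift[OF t] \<open>eps > 0\<close> by (intro order_tendstoD) auto
    hence "\<forall>\<^sub>F n in sequentially. G (t + h n) \<ge> G t - eps * h n"
    proof eventually_elim
      case (elim n)
      thus ?case using h(2)[of n] by (simp add: field_simps)
    qed
    thus "\<exists>h. h \<longlonglongrightarrow> 0 \<and> (\<forall>n. h n > (0::real)) \<and> (\<forall>\<^sub>F n in sequentially. G (t + h n) \<ge> G t - eps * h n)"
      using h by blast
  qed
qed

text \<open>
  The integral of \<open>P t u\<close> against \<open>m\<close> has derivative \<open>0\<close>, since \<open>P t u\<close> is again bounded. Applying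
  monotonicity to \<open>u\<close> and to \<open>- u\<close> gives both inequalities.
\<close>

lemma stationary_if_generator_integral_zero:
  assumes zero: "\<And>v c. (\<And>x. \<bar>v x\<bar> \<le> c) \<Longrightarrow> measure_pmf.expectation m (Q v) = 0"
  shows "stationary_distribution P m"
  unfolding stationary_distribution_def
proof (intro allI impI)
  fix t :: real assume t: "t \<ge> 0"
  have le: "measure_pmf.expectation m u \<le> measure_pmf.expectation (bind_pmf m (P t)) u"
    if u: "\<And>x. \<bar>u x\<bar> \<le> 1" for u :: "'a \<Rightarrow> real"
  proof -
    define G where "G t = measure_pmf.expectation m (\<lambda>x. measure_pmf.expectation (P t x) u)" for t
    have "G 0 \<le> G t"
    proof (rule nondecreasing_along_semigroup[where m = "\<lambda>_. m" and v = "\<lambda>t x. measure_pmf.expectation (P t x) u"])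
      show bd: "\<bar>measure_pmf.expectation (P t x) u\<bar> \<le> 1" for t x using u by (rule expectation_bounded)
      show "0 \<le> measure_pmf.expectation m (Q (\<lambda>x. measure_pmf.expectation (P t x) u))" for t
        using zero[OF bd[of t]] by simp
      show "G (t + h) = measure_pmf.expectation m
             (\<lambda>x. measure_pmf.expectation (P h x) (\<lambda>y. measure_pmf.expectation (P t y) u))"
        if "t \<ge> 0" "h \<ge> 0" for t h
        using that Chapman_Kolmogorov[of h t]
        by (simp add: G_def add.commute expectation_bind_pmf[where f = u and c = 1, OF u])
    qed (simp_all add: G_def t)
    thus ?thesis using expectation_bind_pmf[OF u, of m "P t"] by (simp add: G_def P_0)
  qed
  show "bind_pmf m (P t) = m"
  proof (rule pmf_eqI_expectation)
    fix u :: "'a \<Rightarrow> real" assume u: "\<And>x. \<bar>u x\<bar> \<le> 1"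
    show "measure_pmf.expectation (bind_pmf m (P t)) u = measure_pmf.expectation m u"
      using le[of u] le[of "\<lambda>x. - u x"] u by simp
  qed
qed

text \<open>
  Outside of \<open>S\<close>, the generator applied to the indicator of \<open>S\<close> is nonnegative as a limit of
  nonnegative quotients, so the probability of being in \<open>S\<close> cannot decrease.
\<close>

lemma absorbing_if_no_exit_rate:
  assumes no_exit: "\<And>x. x \<in> S \<Longrightarrow> 0 \<le> Q (indicator S) x"
    and "x \<in> S" "t \<ge> 0" "y \<notin> S"
  shows "pmf (P t x) y = 0"
proof -
  define G :: "real \<Rightarrow> real" where "G t = measure_pmf.expectation (P t x) (indicator S)" for t
  have ind: "\<bar>indicator S y :: real\<bar> \<le> 1" for y by (simp add: indicator_def)
  have "0 \<le> Q (indicator S) y" for y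
  proof (cases "y \<in> S")
    case False
    show ?thesis
    proof (rule tendsto_lowerbound[OF generator_tendsto[of "indicator S" 1 y]])
      show "\<forall>\<^sub>F t in at_right 0. 0 \<le> (measure_pmf.expectation (P t y) (indicator S) - indicator S y) / t"
        using eventually_at_right_less[of "0::real"] by eventually_elim (use False in simp)
    qed (auto simp: indicator_def)
  qed (rule no_exit)
  note drift = this
  have "G 0 \<le> G t"
  proof (rule nondecreasing_along_semigroup[where m = "\<lambda>t. P t x" and v = "\<lambda>_. indicator S"])
    show "\<bar>indicator S y :: real\<bar> \<le> 1" for y by (rule ind)
    show "0 \<le> measure_pmf.expectation (P t x) (Q (indicator S))" for t
      using drift by (intro integral_nonneg_AE) (auto intro!: AE_pmfI)
    show "G (t + h) = measure_pmf.expectation (P t x) (\<lambda>x. measure_pmf.expectation (P h x) (indicator S))"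
      if "t \<ge> 0" "h \<ge> 0" for t h
      using that Chapman_Kolmogorov[of t h] expectation_bind_pmf[where f = "indicator S :: _ \<Rightarrow> real" and c = 1, OF ind]
      by (simp add: G_def)
  qed (simp_all add: G_def \<open>t \<ge> 0\<close>)
  hence "measure_pmf.prob (P t x) S \<ge> 1"
    using \<open>x \<in> S\<close> by (simp add: G_def P_0)
  hence "measure_pmf.prob (P t x) S = 1"
    using measure_pmf.prob_le_1[of "P t x" S] by linarith
  hence "AE y in P t x. y \<in> S" by (simp add: measure_pmf.prob_eq_1)
  thus ?thesis using \<open>y \<notin> S\<close> by (auto simp: AE_measure_pmf_iff set_pmf_eq)
qed

end

text \<open>
  Averaging the convergence \<open>pmf (P t x) y \<longlongrightarrow> pmf q y\<close> over \<open>x\<close> with respect to \<open>m\<close> leaves the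
  left hand side constant in \<open>t\<close>.
\<close>

lemma ergodic_stationary_unique:
  assumes "stationary_distribution P m"
    and lim: "\<And>x y. ((\<lambda>t. pmf (P t x) y) \<longlongrightarrow> pmf q y) at_top"
  shows "m = q"
proof (rule pmf_eqI)
  fix y
  have "((\<lambda>t. measure_pmf.expectation m (\<lambda>x. pmf (P t x) y)) \<longlongrightarrow> measure_pmf.expectation m (\<lambda>x. pmf q y)) at_top"
    by (rule integral_dominated_convergence_at_top[where w = "\<lambda>_. 1"]) (auto simp: lim pmf_le_1)
  moreover have "\<forall>\<^sub>F t in at_top. measure_pmf.expectation m (\<lambda>x. pmf (P t x) y) = pmf m y"
    using eventually_ge_at_top[of "0::real"]
  proof eventually_elim
    case (elim t)
    thus ?case using assms(1) by (simp add: stationary_distribution_def pmf_bind[symmetric])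
  qed
  ultimately have "((\<lambda>t. pmf m y) \<longlongrightarrow> pmf q y) (at_top :: real filter)"
    by (simp add: tendsto_cong)
  thus "pmf m y = pmf q y" by (simp add: tendsto_const_iff)
qed

section \<open>Sums against probability mass functions\<close>

lemma has_sum_sum_finite:
  fixes f :: "'i \<Rightarrow> 'a \<Rightarrow> real"
  assumes "finite I" "\<And>i. i \<in> I \<Longrightarrow> (f i has_sum s i) A"
  shows "((\<lambda>x. \<Sum>i\<in>I. f i x) has_sum (\<Sum>i\<in>I. s i)) A"
  using assms by (induction I rule: finite_induct) (auto intro!: has_sum_add)

lemma has_sum_finite_fibres:
  fixes h :: "'d::finite \<times> 'n \<Rightarrow> real"
  assumes "\<And>D. ((\<lambda>n. h (D, n)) has_sum s D) UNIV"
  shows "(h has_sum (\<Sum>D\<in>UNIV. s D)) UNIV"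
proof -
  have "(\<lambda>n. norm (h (D, n))) summable_on UNIV" for D
    unfolding summable_on_iff_abs_summable_on_real[of "\<lambda>n. h (D, n)", symmetric]
    using assms[of D] by (rule has_sum_imp_summable)
  hence "(\<lambda>x. norm (h x)) summable_on (Sigma UNIV (\<lambda>_. UNIV))"
    by (intro summable_on_SigmaI[where g = "\<lambda>D. infsum (\<lambda>n. norm (h (D, n))) UNIV"]) auto
  hence "h summable_on (Sigma UNIV (\<lambda>_. UNIV))"
    by (rule abs_summable_summable)
  thus ?thesis
    using has_sum_SigmaI[where A = UNIV and f = h and g = s and B = "\<lambda>_. UNIV" and S = "\<Sum>D\<in>UNIV. s D"] assms
    by (simp add: has_sum_finiteI)
qed

lemma integrable_pmf_iff_summable_on:
  fixes h :: "'a \<Rightarrow> real"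
  shows "integrable (measure_pmf p) h \<longleftrightarrow> (\<lambda>x. pmf p x * h x) summable_on UNIV"
proof -
  have "integrable (measure_pmf p) h \<longleftrightarrow> Infinite_Set_Sum.abs_summable_on (\<lambda>x. pmf p x * h x) UNIV"
    unfolding measure_pmf_eq_density Infinite_Set_Sum.abs_summable_on_def
    by (subst integrable_density) auto
  thus ?thesis
    unfolding abs_summable_equivalent[symmetric] summable_on_iff_abs_summable_on_real[symmetric] .
qed

lemma expectation_eq_has_sum:
  fixes h :: "'a \<Rightarrow> real"
  assumes "((\<lambda>x. pmf p x * h x) has_sum s) UNIV"
  shows "measure_pmf.expectation p h = s"
proof -
  have "Infinite_Set_Sum.abs_summable_on (\<lambda>x. pmf p x * h x) UNIV"
    unfolding abs_summable_equivalent[symmetric] summable_on_iff_abs_summable_on_real[symmetric]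
    using assms by (rule has_sum_imp_summable)
  from infsetsum_infsum[OF this] show ?thesis
    using assms by (simp add: pmf_expectation_eq_infsetsum infsumI)
qed

text \<open>
  The form of the Cauchy-Schwarz inequality that makes every sum in the theorem converge.
\<close>

lemma summable_on_mult_of_squares:
  fixes w u v :: "'a \<Rightarrow> real"
  assumes "\<And>x. x \<in> A \<Longrightarrow> w x \<ge> 0"
    and "(\<lambda>x. w x * (u x)\<^sup>2) summable_on A" "(\<lambda>x. w x * (v x)\<^sup>2) summable_on A"
  shows "(\<lambda>x. w x * (u x * v x)) summable_on A"
proof -
  have sq: "(\<lambda>x. w x * (u x)\<^sup>2 + w x * (v x)\<^sup>2) summable_on A"
    using assms by (intro summable_on_add)
  have le: "\<bar>w x * (u x * v x)\<bar> \<le> w x * (u x)\<^sup>2 + w x * (v x)\<^sup>2" if "x \<in> A" for x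
  proof -
    have "2 * (\<bar>u x\<bar> * \<bar>v x\<bar>) \<le> (u x)\<^sup>2 + (v x)\<^sup>2"
      using sum_squares_bound[of "\<bar>u x\<bar>" "\<bar>v x\<bar>"] by simp
    moreover have "0 \<le> \<bar>u x\<bar> * \<bar>v x\<bar>" by simp
    ultimately have "\<bar>u x * v x\<bar> \<le> (u x)\<^sup>2 + (v x)\<^sup>2"
      unfolding abs_mult by linarith
    hence "w x * \<bar>u x * v x\<bar> \<le> w x * ((u x)\<^sup>2 + (v x)\<^sup>2)"
      using assms(1)[OF that] by (rule mult_left_mono)
    thus ?thesis using assms(1)[OF that] by (simp add: abs_mult distrib_left)
  qed
  show ?thesis
    unfolding summable_on_iff_abs_summable_on_real[of "\<lambda>x. w x * (u x * v x)"]
    by (rule Infinite_Sum.abs_summable_on_comparison_test'[OF sq]) (use le in auto)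
qed

lemma summable_on_mult_bounded:
  fixes u b :: "'a \<Rightarrow> real"
  assumes "u summable_on A" and "\<And>x. x \<in> A \<Longrightarrow> \<bar>b x\<bar> \<le> c"
  shows "(\<lambda>x. b x * u x) summable_on A"
proof -
  have "(\<lambda>x. c * \<bar>u x\<bar>) summable_on A"
    using assms(1)[unfolded summable_on_iff_abs_summable_on_real[of u]]
    by (intro summable_on_cmult_right) simp
  thus ?thesis
    unfolding summable_on_iff_abs_summable_on_real[of "\<lambda>x. b x * u x"]
    by (rule Infinite_Sum.abs_summable_on_comparison_test') (simp add: abs_mult mult_right_mono assms(2))
qed

section \<open>Invariant vectors of stochastic matrices\<close>

text \<open>
  A zero of an invariant vector \<open>y \<ge> 0\<close> forces zeros at all predecessors of that state,
  and by irreducibility every state leads to it.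
\<close>

lemma nonneg_invariant_vector_zero:
  fixes y :: "'a::finite \<Rightarrow> real"
  assumes "stochastic_on UNIV r" "irreducible_matrix r"
    and "\<And>j. y j \<ge> 0" "\<And>j. y j = (\<Sum>i\<in>UNIV. y i * r i j)" and "y b = 0"
  shows "y a = 0"
proof -
  have "(a, b) \<in> {(k, l). 0 < r k l}\<^sup>*" using assms(2) by (simp add: irreducible_matrix_def)
  thus ?thesis
  proof (induction rule: converse_rtrancl_induct)
    case (step k l)
    have "y k * r k l \<le> (\<Sum>i\<in>UNIV. y i * r i l)"
      using assms(1,3) by (intro member_le_sum) (auto simp: stochastic_on_def)
    hence "y k * r k l \<le> 0" using step.IH assms(4)[of l] by simp
    thus ?case using step.hyps(1) assms(3)[of k] by (simp add: mult_le_0_iff)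
  qed (rule assms(5))
qed

text \<open>
  Traffic equations alone do not say that their solution is nonnegative. By the triangle inequality
  \<open>\<bar>x\<bar>\<close> is subinvariant, and as \<open>r\<close> preserves total mass it is invariant. Hence \<open>\<bar>x\<bar> - x\<close> is a
  nonnegative invariant vector that vanishes at \<open>b\<close>, so it vanishes everywhere. Likewise a zero of \<open>\<bar>x\<bar>\<close> would spread to \<open>b\<close>.
\<close>

lemma invariant_vector_pos:
  fixes x :: "'a::finite \<Rightarrow> real"
  assumes r: "stochastic_on UNIV r" "irreducible_matrix r"
    and inv: "\<And>j. x j = (\<Sum>i\<in>UNIV. x i * r i j)" and "x b > 0"
  shows "x a > 0"
proof -
  have r0: "r i j \<ge> 0" and r1: "(\<Sum>j\<in>UNIV. r i j) = 1" for i j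
    using r(1) by (auto simp: stochastic_on_def)
  have le: "\<bar>x j\<bar> \<le> (\<Sum>i\<in>UNIV. \<bar>x i\<bar> * r i j)" for j
  proof -
    have "\<bar>x j\<bar> = \<bar>\<Sum>i\<in>UNIV. x i * r i j\<bar>" using inv[of j] by simp
    also have "\<dots> \<le> (\<Sum>i\<in>UNIV. \<bar>x i * r i j\<bar>)" by (rule sum_abs)
    finally show ?thesis using r0 by (simp add: abs_mult)
  qed
  have "(\<Sum>j\<in>UNIV. \<Sum>i\<in>UNIV. \<bar>x i\<bar> * r i j) = (\<Sum>i\<in>UNIV. \<bar>x i\<bar>)"
    by (subst sum.swap) (simp add: sum_distrib_left[symmetric] r1)
  hence "(\<Sum>j\<in>UNIV. (\<Sum>i\<in>UNIV. \<bar>x i\<bar> * r i j) - \<bar>x j\<bar>) = 0"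
    by (simp add: sum_subtractf)
  hence abs_inv: "\<bar>x j\<bar> = (\<Sum>i\<in>UNIV. \<bar>x i\<bar> * r i j)" for j
    using le by (subst (asm) sum_nonneg_eq_0_iff) auto
  have "\<bar>x a\<bar> - x a = 0"
  proof (rule nonneg_invariant_vector_zero[OF r, of "\<lambda>j. \<bar>x j\<bar> - x j" b])
    show "\<bar>x j\<bar> - x j = (\<Sum>i\<in>UNIV. (\<bar>x i\<bar> - x i) * r i j)" for j
      using abs_inv[of j] inv[of j] by (simp add: left_diff_distrib sum_subtractf)
  qed (use \<open>x b > 0\<close> in auto)
  moreover have "\<bar>x a\<bar> \<noteq> 0"
  proof
    assume "\<bar>x a\<bar> = 0"
    from nonneg_invariant_vector_zero[OF r, of "\<lambda>j. \<bar>x j\<bar>" a b, OF _ abs_inv this]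
    show False using \<open>x b > 0\<close> by simp
  qed
  ultimately show ?thesis by linarith
qed

section \<open>The product form distribution\<close>

lemma e_None [simp]: "e None = 0"
  by (simp add: e_def fun_eq_iff)

lemma sum_nodes0: "(\<Sum>j\<in>nodes0 D. F j) = F None + (\<Sum>j\<in>- D. F (Some j))"
  for D :: "'j::finite set" and F :: "_ \<Rightarrow> real"
  unfolding nodes0_def by (subst sum.insert) (auto simp: sum.reindex)

lemma add_diff_e [simp]: "n + e j - e j = n" for n :: "'j \<Rightarrow> nat"
  by (simp add: fun_eq_iff)

text \<open>
  Arrivals from outside are treated as departures from the node \<open>0\<close>, so that all jumps \<open>n \<mapsto> n - e j + e i\<close>
  of the queue lengths have the same form, with rate \<open>departure_rate lam mu n j * RD D j i\<close>.
\<close>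

definition departure_rate :: "real \<Rightarrow> ('j \<Rightarrow> nat \<Rightarrow> real) \<Rightarrow> ('j \<Rightarrow> nat) \<Rightarrow> 'j option \<Rightarrow> real" where
  "departure_rate lam mu n j = (case j of None \<Rightarrow> lam | Some i \<Rightarrow> mu i (n i))"

text \<open>
  As \<open>qY\<close> vanishes at incomparable and at equal pairs, the two sums over subsets and supersets
  combine into an unrestricted one, in which
  the order of summation can be exchanged.
\<close>

lemma qY_sum:
  fixes F :: "'j::finite set \<Rightarrow> real"
  shows "(\<Sum>H | H \<subset> D. qY A B D H * F H) + (\<Sum>I | D \<subset> I. qY A B D I * F I) = (\<Sum>I\<in>UNIV. qY A B D I * F I)"
proof -
  have "(\<Sum>I\<in>UNIV. qY A B D I * F I) = (\<Sum>I\<in>{H. H \<subset> D} \<union> {I. D \<subset> I}. qY A B D I * F I)"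
    by (rule sum.mono_neutral_right) (auto simp: qY_def)
  also have "\<dots> = (\<Sum>H | H \<subset> D. qY A B D H * F H) + (\<Sum>I | D \<subset> I. qY A B D I * F I)"
    by (rule sum.union_disjoint) auto
  finally show ?thesis by simp
qed

context unreliable_jackson_network
begin

abbreviation "eta_0 \<equiv> eta0 lam eta"
abbreviation "svc \<equiv> departure_rate lam mu"

lemma RD_nonneg: "i \<in> nodes0 D \<Longrightarrow> j \<in> nodes0 D \<Longrightarrow> 0 \<le> RD D i j"
  using RD_stochastic[of D] by (auto simp: stochastic_on_def)

lemma RD_row_sum: "i \<in> nodes0 D \<Longrightarrow> (\<Sum>j\<in>nodes0 D. RD D i j) = 1"
  using RD_stochastic[of D] by (auto simp: stochastic_on_def)

text \<open>
  For \<open>j \<noteq> None\<close> this is the traffic equation. The equation at \<open>None\<close> follows from the others,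
  because the total mass is preserved.
\<close>

lemma eta0_invariant:
  assumes "j \<in> nodes0 D"
  shows "eta_0 j = (\<Sum>i\<in>nodes0 D. eta_0 i * RD D i j)"
proof (cases j)
  case (Some k)
  hence "k \<notin> D" using assms by (auto simp: nodes0_def)
  thus ?thesis using Some RD_traffic[of k D] by (simp add: sum_nodes0 eta0_def)
next
  case None
  have Some_eq: "eta_0 (Some k) = (\<Sum>i\<in>nodes0 D. eta_0 i * RD D i (Some k))" if "k \<in> - D" for k
    using that RD_traffic[of k D] by (auto simp: sum_nodes0 eta0_def)
  have "(\<Sum>j\<in>nodes0 D. \<Sum>i\<in>nodes0 D. eta_0 i * RD D i j) = (\<Sum>i\<in>nodes0 D. eta_0 i)"
    by (subst sum.swap) (simp add: sum_distrib_left[symmetric] RD_row_sum)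
  hence "(\<Sum>i\<in>nodes0 D. eta_0 i * RD D i None) + (\<Sum>k\<in>- D. eta_0 (Some k)) = (\<Sum>i\<in>nodes0 D. eta_0 i)"
    using Some_eq by (simp add: sum_nodes0[of "\<lambda>j. \<Sum>i\<in>nodes0 D. eta_0 i * RD D i j"])
  thus ?thesis by (simp add: sum_nodes0[of eta_0] None)
qed

lemma eta0_pos: "eta_0 j > 0"
proof (rule invariant_vector_pos[OF R_stochastic R_irreducible, of _ None])
  have *: "nodes0 {} = (UNIV :: 'j option set)"
    by (simp add: nodes0_def UNIV_option_conv)
  show "eta_0 j = (\<Sum>i\<in>UNIV. eta_0 i * R i j)" for j
    using eta0_invariant[of j "{}"] by (simp add: * RD_empty)
  show "eta_0 None > 0" using lam_pos by (simp add: eta0_def)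
qed

lemma eta_pos: "eta j > 0"
  using eta0_pos[of "Some j"] by (simp add: eta0_def)

lemma mu_nonneg: "0 \<le> mu j k"
  using mu_0[of j] mu_pos[of k j] by (cases k) auto

lemma svc_nonneg: "0 \<le> svc n j"
  using lam_pos mu_nonneg by (auto simp: departure_rate_def split: option.split)

definition queue_weight :: "'j \<Rightarrow> nat \<Rightarrow> real" where
  "queue_weight j m = (\<Prod>k=1..m. eta j / mu j k)"

lemma queue_weight_pos: "queue_weight j m > 0"
  unfolding queue_weight_def using eta_pos mu_pos by (intro prod_pos) auto

definition queue_pmf :: "'j \<Rightarrow> nat pmf" where
  "queue_pmf j = embed_pmf (\<lambda>m. queue_weight j m / suminf (queue_weight j))"

lemma pmf_queue: "pmf (queue_pmf j) m = queue_weight j m / suminf (queue_weight j)"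
proof -
  have sm: "summable (queue_weight j)"
    using network_ergodic[of j] by (simp add: queue_weight_def[abs_def])
  have pos: "suminf (queue_weight j) > 0"
    using sm queue_weight_pos by (rule suminf_pos)
  have nonneg: "0 \<le> queue_weight j m / suminf (queue_weight j)" for m
    using queue_weight_pos[of j m] pos by simp
  have "(\<integral>\<^sup>+m. ennreal (queue_weight j m / suminf (queue_weight j)) \<partial>count_space UNIV)
      = (\<Sum>m. ennreal (queue_weight j m / suminf (queue_weight j)))"
    by (rule nn_integral_count_space_nat)
  also have "\<dots> = ennreal (\<Sum>m. queue_weight j m / suminf (queue_weight j))"
    by (rule suminf_ennreal2[OF nonneg summable_divide[OF sm]])
  also have "\<dots> = 1"
    using pos sm by (simp add: suminf_divide)
  finally show ?thesis unfolding queue_pmf_def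
    using nonneg by (intro pmf_embed_pmf)
qed

lemma queue_balance: "pmf (queue_pmf j) (Suc m) * mu j (Suc m) = eta j * pmf (queue_pmf j) m"
  using mu_pos[of "Suc m" j] by (simp add: pmf_queue queue_weight_def)

definition queues_pmf :: "('j \<Rightarrow> nat) pmf" where
  "queues_pmf = Pi_pmf UNIV 0 queue_pmf"

text \<open>
  Only the factor of node \<open>j\<close> changes, by \<open>eta j / mu j (n j + 1)\<close>. For \<open>j = None\<close> both sides are \<open>lam\<close> times the weight of \<open>n\<close>.
\<close>

lemma queues_balance:
  "pmf queues_pmf (n + e j) * svc (n + e j) j = pmf queues_pmf n * eta_0 j"
proof (cases j)
  case (Some i)
  have eq: "pmf queues_pmf n' = pmf (queue_pmf i) (n' i) * (\<Prod>k\<in>UNIV - {i}. pmf (queue_pmf k) (n' k))" for n'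
    unfolding queues_pmf_def by (subst pmf_Pi') (auto simp: prod.remove)
  have "(\<Prod>k\<in>UNIV - {i}. pmf (queue_pmf k) ((n + e j) k)) = (\<Prod>k\<in>UNIV - {i}. pmf (queue_pmf k) (n k))"
    by (rule prod.cong) (auto simp: Some e_def)
  moreover have "(n + e j) i = Suc (n i)" by (simp add: Some e_def)
  ultimately show ?thesis
    using queue_balance[of i "n i"] unfolding eq
    by (simp add: Some departure_rate_def eta0_def mult_ac)
qed (simp add: departure_rate_def eta0_def)

text \<open>
  This is the change of variables \<open>n \<mapsto> n + e j\<close>. Vectors that are not of the form \<open>n + e j\<close> have
  no customer at \<open>j\<close> and carry the factor \<open>mu j 0 = 0\<close>.
\<close>

lemma queues_shift:
  fixes F :: "('j \<Rightarrow> nat) \<Rightarrow> real"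
  shows "((\<lambda>n. pmf queues_pmf n * svc n j * F n) has_sum s) UNIV \<longleftrightarrow>
         ((\<lambda>n. pmf queues_pmf n * eta_0 j * F (n + e j)) has_sum s) UNIV"
proof -
  have off: "svc n j = 0" if "n \<notin> range (\<lambda>n. n + e j)" for n
  proof (cases j)
    case None
    thus ?thesis using that by auto
  next
    case (Some i)
    have "n i = 0"
    proof (rule ccontr)
      assume "n i \<noteq> 0"
      hence "n = (n - e j) + e j" by (auto simp: Some e_def fun_eq_iff)
      thus False using that by blast
    qed
    thus ?thesis by (simp add: Some departure_rate_def mu_0)
  qed
  have "((\<lambda>n. pmf queues_pmf n * svc n j * F n) has_sum s) UNIV \<longleftrightarrow>
        ((\<lambda>n. pmf queues_pmf n * svc n j * F n) has_sum s) (range (\<lambda>n. n + e j))"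
    by (rule has_sum_cong_neutral) (auto simp: off)
  also have "\<dots> \<longleftrightarrow> ((\<lambda>n. pmf queues_pmf (n + e j) * svc (n + e j) j * F (n + e j)) has_sum s) UNIV"
    by (subst has_sum_reindex) (auto simp: o_def inj_on_def)
  finally show ?thesis by (simp add: queues_balance)
qed

subsection \<open>Jump rates\<close>

definition total_rate :: "'j set \<Rightarrow> ('j \<Rightarrow> nat) \<Rightarrow> real" where
  "total_rate D n = (\<Sum>I\<in>UNIV. qY A B D I) + lam + (\<Sum>j\<in>- D. mu j (n j))"

lemma qY_nonneg: "0 \<le> qY A B D I"
  using A_nonneg B_nonneg by (simp add: qY_def)

lemma svc_bound: "\<exists>M\<ge>0. \<forall>n j. svc n j \<le> M"
proof -
  obtain M where M: "\<And>j k. mu j k \<le> M" using mu_bounded by (auto simp: bdd_above_def)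
  show ?thesis
    using M lam_pos
    by (intro exI[of _ "max lam M"]) (auto simp: departure_rate_def le_max_iff_disj split: option.split)
qed

lemma total_rate_bound: "\<exists>K\<ge>0. \<forall>D n. 0 \<le> total_rate D n \<and> total_rate D n \<le> K"
proof -
  obtain M where M: "M \<ge> 0" "\<And>n j. svc n j \<le> M" using svc_bound by blast
  have mu_le: "mu j k \<le> M" for j k
    using M(2)[of "\<lambda>_. k" "Some j"] by (simp add: departure_rate_def)
  define K where "K = (\<Sum>D\<in>UNIV. \<Sum>I\<in>UNIV. qY A B D I) + lam + (\<Sum>j\<in>(UNIV::'j set). M)"
  have "total_rate D n \<le> K" for D n
  proof -
    have "(\<Sum>I\<in>UNIV. qY A B D I) \<le> (\<Sum>D\<in>UNIV. \<Sum>I\<in>UNIV. qY A B D I)"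
      by (rule member_le_sum) (auto intro: sum_nonneg qY_nonneg)
    moreover have "(\<Sum>j\<in>- D. mu j (n j)) \<le> (\<Sum>j\<in>- D. M)" by (rule sum_mono) (rule mu_le)
    moreover have "(\<Sum>j\<in>- D. M) \<le> (\<Sum>j\<in>(UNIV::'j set). M)"
      by (intro sum_mono2) (use M in auto)
    ultimately show ?thesis by (simp add: total_rate_def K_def)
  qed
  moreover have nonneg: "0 \<le> total_rate D n" for D n
    unfolding total_rate_def using lam_pos by (intro add_nonneg_nonneg sum_nonneg qY_nonneg mu_nonneg) auto
  moreover have "0 \<le> K"
    using calculation(1)[of undefined undefined] nonneg[of undefined undefined] by linarith
  ultimately show ?thesis by blast
qed

text \<open>
  The differences that define the generator separate into gains and a total exit rate because the rows of
  \<open>RD D\<close> sum to \<open>1\<close>. Moves from a node to itself, and from \<open>None\<close> to \<open>None\<close>, contribute \<open>0\<close> to the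
  generator, yet have to be counted in both parts for the exit rate not to depend on the routing.
\<close>

lemma QZ_jump_form:
  "QZ lam mu A B RD g (D, n) =
     (\<Sum>I\<in>UNIV. qY A B D I * g (I, n))
   + (\<Sum>j\<in>nodes0 D. \<Sum>i\<in>nodes0 D. svc n j * RD D j i * g (D, n - e j + e i))
   - total_rate D n * g (D, n)"
proof -
  have Y: "QY A B (\<lambda>D'. g (D', n)) D = (\<Sum>I\<in>UNIV. qY A B D I * g (I, n)) - (\<Sum>I\<in>UNIV. qY A B D I) * g (D, n)"
    unfolding QY_def qY_sum by (simp add: right_diff_distrib sum_subtractf sum_distrib_right)
  have row: "(\<Sum>i\<in>nodes0 D. svc n j * RD D j i * G i) - svc n j * c
     = (\<Sum>i\<in>nodes0 D. svc n j * RD D j i * (G i - c))" if "j \<in> nodes0 D" for j c and G :: "_ \<Rightarrow> real"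
  proof -
    have "(\<Sum>i\<in>nodes0 D. svc n j * RD D j i * c) = (\<Sum>i\<in>nodes0 D. RD D j i) * (svc n j * c)"
      unfolding sum_distrib_right by (rule sum.cong) (simp_all add: mult_ac)
    thus ?thesis using RD_row_sum[OF that] by (simp add: right_diff_distrib sum_subtractf)
  qed
  have "lam + (\<Sum>j\<in>- D. mu j (n j)) = (\<Sum>j\<in>nodes0 D. svc n j)"
    by (simp add: sum_nodes0 departure_rate_def)
  hence "(\<Sum>j\<in>nodes0 D. \<Sum>i\<in>nodes0 D. svc n j * RD D j i * g (D, n - e j + e i)) - (lam + (\<Sum>j\<in>- D. mu j (n j))) * g (D, n)
    = (\<Sum>j\<in>nodes0 D. (\<Sum>i\<in>nodes0 D. svc n j * RD D j i * g (D, n - e j + e i)) - svc n j * g (D, n))"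
    by (simp add: sum_distrib_right sum_subtractf)
  also have "\<dots> = (\<Sum>j\<in>nodes0 D. \<Sum>i\<in>nodes0 D. svc n j * RD D j i * (g (D, n - e j + e i) - g (D, n)))"
    by (intro sum.cong refl row)
  also have "\<dots> = (\<Sum>j\<in>- D. lam * RD D None (Some j) * (g (D, n + e (Some j)) - g (D, n)))
   + (\<Sum>j\<in>- D. mu j (n j) * RD D (Some j) None * (g (D, n - e (Some j)) - g (D, n)))
   + (\<Sum>j\<in>- D. mu j (n j) *
        (\<Sum>i\<in>- D. RD D (Some j) (Some i) * (g (D, n - e (Some j) + e (Some i)) - g (D, n))))"
    by (simp add: sum_nodes0 departure_rate_def sum.distrib sum_distrib_left mult.assoc)
  finally have X: "\<dots> = (\<Sum>j\<in>nodes0 D. \<Sum>i\<in>nodes0 D. svc n j * RD D j i * g (D, n - e j + e i))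
    - (lam + (\<Sum>j\<in>- D. mu j (n j))) * g (D, n)" ..
  show ?thesis
    unfolding QZ_def total_rate_def prod.case X Y by (simp only: distrib_right)
qed

end

section \<open>The generator under the product form\<close>

text \<open>
  The breakdown factor \<open>A D / B D\<close> of the product form makes sense only where \<open>B\<close> does not vanish.
  That this follows from ergodicity is shown in \<open>ergodic_imp_B_pos\<close>.
\<close>

locale repairable_jackson_network = unreliable_jackson_network lam R mu eta A B RD
  for lam :: real
    and R :: "'j::finite option \<Rightarrow> 'j option \<Rightarrow> real"
    and mu :: "'j \<Rightarrow> nat \<Rightarrow> real"
    and eta :: "'j \<Rightarrow> real"
    and A B :: "'j set \<Rightarrow> real"
    and RD :: "'j set \<Rightarrow> 'j option \<Rightarrow> 'j option \<Rightarrow> real" +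
  assumes B_pos: "\<And>D. 0 < B D"
begin

definition breakdown_pmf :: "'j set pmf" where
  "breakdown_pmf = embed_pmf (\<lambda>D. A D / B D / (\<Sum>D\<in>UNIV. A D / B D))"

lemma pmf_breakdown: "pmf breakdown_pmf D = A D / B D / (\<Sum>D\<in>UNIV. A D / B D)"
proof -
  define C where "C = (\<Sum>D\<in>UNIV. A D / B D)"
  have "A {} / B {} \<le> C" unfolding C_def
    by (rule member_le_sum) (auto simp: A_nonneg less_imp_le[OF B_pos])
  hence C: "C > 0" by (simp add: A_empty B_empty)
  have nonneg: "0 \<le> A D / B D / C" for D
    using A_nonneg[of D] B_pos[of D] C by simp
  have "(\<integral>\<^sup>+D. ennreal (A D / B D / C) \<partial>count_space UNIV) = (\<Sum>D\<in>UNIV. ennreal (A D / B D / C))"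
    by (rule nn_integral_count_space_finite) simp
  also have "\<dots> = ennreal (\<Sum>D\<in>UNIV. A D / B D / C)"
    by (rule sum_ennreal) (rule nonneg)
  also have "(\<Sum>D\<in>UNIV. A D / B D / C) = (\<Sum>D\<in>UNIV. A D / B D) / C"
    by (simp only: sum_divide_distrib)
  also have "ennreal \<dots> = 1" unfolding C_def[symmetric] using C by simp
  finally show ?thesis
    unfolding breakdown_pmf_def C_def[symmetric] using nonneg by (intro pmf_embed_pmf)
qed

lemma A_zero_mono:
  assumes "D \<subset> I" "A D = 0"
  shows "A I = 0"
proof (rule ccontr)
  assume "A I \<noteq> 0"
  hence "A I > 0" using A_nonneg[of I] by simp
  thus False using A_finite[OF assms(1)] assms(2) by simp
qed

text \<open>
  Where \<open>A D = 0\<close>, the quotient \<open>A I / A D\<close> is \<open>0\<close>, and both sides vanish since then also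
  \<open>A I = 0\<close> for all larger \<open>I\<close>.
\<close>

lemma breakdown_detailed_balance:
  "pmf breakdown_pmf D * qY A B D I = pmf breakdown_pmf I * qY A B I D"
proof -
  have *: "A D / B D * (A I / A D) = A I / B I * (B I / B D)" if "D \<subset> I" for D I
    using A_zero_mono[OF that] B_pos[of D] B_pos[of I] by (cases "A D = 0") auto
  have "A D / B D * qY A B D I = A I / B I * qY A B I D"
  proof -
    consider "D \<subset> I" "\<not> I \<subset> D" | "I \<subset> D" "\<not> D \<subset> I" | "\<not> D \<subset> I" "\<not> I \<subset> D" by blast
    thus ?thesis
    proof cases
      case 1
      thus ?thesis using *[of D I] by (simp add: qY_def)
    next
      case 2
      thus ?thesis using *[of I D] by (simp add: qY_def)
    qed (simp add: qY_def)
  qed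
  thus ?thesis unfolding pmf_breakdown by (simp only: times_divide_eq_left)
qed

definition product_form :: "'j state pmf" where
  "product_form = pair_pmf breakdown_pmf queues_pmf"

lemma pmf_product_form: "pmf product_form (D, n) = pmf breakdown_pmf D * pmf queues_pmf n"
  by (simp add: product_form_def pmf_pair)

lemma summable_on_square:
  assumes "square_integrable product_form f"
  shows "(\<lambda>n. pmf product_form (D, n) * (f (D, n))\<^sup>2) summable_on UNIV"
proof -
  have "(\<lambda>x. pmf product_form x * (f x)\<^sup>2) summable_on range (Pair D)"
    using assms by (auto simp: square_integrable_def integrable_pmf_iff_summable_on intro: summable_on_subset_banach)
  thus ?thesis by (subst (asm) summable_on_reindex) (auto simp: o_def inj_on_def)
qed

lemma product_form_shift:
  fixes F :: "('j \<Rightarrow> nat) \<Rightarrow> real"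
  shows "((\<lambda>n. pmf product_form (D, n) * (svc n j * F n)) has_sum s) UNIV \<longleftrightarrow>
         ((\<lambda>n. pmf product_form (D, n) * (eta_0 j * F (n + e j))) has_sum s) UNIV"
  using queues_shift[of j "\<lambda>n. pmf breakdown_pmf D * F n" s]
  by (simp add: pmf_product_form mult_ac)

text \<open>
  Departure rates are bounded and \<open>eta_0 j\<close> is positive, so by \<open>queues_balance\<close> the weight of \<open>n\<close> is at
  most a constant multiple of the weight of \<open>n + e j\<close>.
\<close>

lemma summable_on_square_shift:
  assumes "square_integrable product_form f"
  shows "(\<lambda>n. pmf product_form (D, n) * (f (D, n + e j))\<^sup>2) summable_on UNIV"
proof -
  obtain M where "\<And>n j. svc n j \<le> M" using svc_bound by blast
  hence "(\<lambda>n. svc n j * (pmf product_form (D, n) * (f (D, n))\<^sup>2)) summable_on UNIV"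
    using svc_nonneg by (intro summable_on_mult_bounded[OF summable_on_square[OF assms], of _ M]) auto
  then obtain s where "((\<lambda>n. pmf product_form (D, n) * (svc n j * (f (D, n))\<^sup>2)) has_sum s) UNIV"
    by (auto simp: summable_on_def mult_ac)
  hence "((\<lambda>n. pmf product_form (D, n) * (eta_0 j * (f (D, n + e j))\<^sup>2)) has_sum s) UNIV"
    using product_form_shift[of D j "\<lambda>n. (f (D, n))\<^sup>2" s] by simp
  hence "(\<lambda>n. eta_0 j * (pmf product_form (D, n) * (f (D, n + e j))\<^sup>2)) summable_on UNIV"
    by (auto simp: summable_on_def mult_ac)
  thus ?thesis
    by (rule iffD1[OF summable_on_cmult_right', rotated]) (use eta0_pos[of j] in simp)
qed

text \<open>
  Detailed balance moves the weight of \<open>(D, n)\<close> to \<open>(I, n)\<close>, where \<open>g\<close> is square summable.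
\<close>

lemma summable_on_breakdown_product:
  assumes f: "square_integrable product_form f" and g: "square_integrable product_form g"
  shows "(\<lambda>n. pmf product_form (D, n) * (qY A B D I * f (D, n) * g (I, n))) summable_on UNIV"
proof -
  have sf: "(\<lambda>n. pmf product_form (D, n) * qY A B D I * (f (D, n))\<^sup>2) summable_on UNIV"
    using summable_on_cmult_right[OF summable_on_square[OF f], of "qY A B D I" D] by (simp add: mult_ac)
  have "qY A B I D * (pmf product_form (I, n) * (g (I, n))\<^sup>2)
      = pmf breakdown_pmf I * qY A B I D * (pmf queues_pmf n * (g (I, n))\<^sup>2)" for n
    by (simp add: pmf_product_form mult_ac)
  hence "qY A B I D * (pmf product_form (I, n) * (g (I, n))\<^sup>2)
      = pmf product_form (D, n) * qY A B D I * (g (I, n))\<^sup>2" for n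
    unfolding breakdown_detailed_balance[of I D] by (simp add: pmf_product_form mult_ac)
  moreover have "(\<lambda>n. qY A B I D * (pmf product_form (I, n) * (g (I, n))\<^sup>2)) summable_on UNIV"
    by (intro summable_on_cmult_right summable_on_square g)
  ultimately have sg: "(\<lambda>n. pmf product_form (D, n) * qY A B D I * (g (I, n))\<^sup>2) summable_on UNIV"
    by (simp only:)
  show ?thesis
    using summable_on_mult_of_squares[OF _ sf sg] qY_nonneg[of D I] by (simp add: mult_ac)
qed

lemma summable_on_routing_product:
  assumes "square_integrable product_form f" "square_integrable product_form g"
  shows "(\<lambda>n. pmf product_form (D, n) * (f (D, n + e j) * g (D, n + e i))) summable_on UNIV"
  by (rule summable_on_mult_of_squares) (use assms in \<open>auto intro: summable_on_square_shift\<close>)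

text \<open>
  The identity of the theorem for a fixed set \<open>D\<close> of broken nodes. The breakdown and the exit terms are
  literally those of \<open>QZ_jump_form\<close>; a routing term \<open>svc n j * RD D j i * f (D, n) * g (D, n - e j + e i)\<close>
  is shifted by \<open>e j\<close>, which replaces \<open>svc n j\<close> by \<open>eta_0 j\<close> and symmetrizes the arguments.
\<close>

lemma integral_over_queues:
  assumes f: "square_integrable product_form f" and g: "square_integrable product_form g"
  defines "Y \<equiv> \<lambda>D n. pmf product_form (D, n) * (\<Sum>I\<in>UNIV. qY A B D I * f (D, n) * g (I, n))"
    and "X \<equiv> \<lambda>D n. pmf product_form (D, n) *
           (\<Sum>j\<in>nodes0 D. \<Sum>i\<in>nodes0 D. eta_0 j * RD D j i * f (D, n + e j) * g (D, n + e i))"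
    and "L \<equiv> \<lambda>D n. pmf product_form (D, n) * f (D, n) * g (D, n) * total_rate D n"
  shows "Y D summable_on UNIV" "X D summable_on UNIV" "L D summable_on UNIV"
    and "((\<lambda>n. pmf product_form (D, n) * (f (D, n) * QZ lam mu A B RD g (D, n)))
           has_sum (infsum (Y D) UNIV + infsum (X D) UNIV - infsum (L D) UNIV)) UNIV"
proof -
  have "(\<lambda>n. \<Sum>I\<in>UNIV. pmf product_form (D, n) * (qY A B D I * f (D, n) * g (I, n))) summable_on UNIV"
    by (rule has_sum_imp_summable, rule has_sum_sum_finite[OF finite has_sum_infsum],
        rule summable_on_breakdown_product[OF f g])
  thus Y: "Y D summable_on UNIV" by (simp add: Y_def sum_distrib_left)

  obtain K where K: "\<And>D n. 0 \<le> total_rate D n \<and> total_rate D n \<le> K"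
    using total_rate_bound by blast
  have "(\<lambda>n. pmf product_form (D, n) * (f (D, n) * g (D, n))) summable_on UNIV"
    using summable_on_routing_product[OF f g, of D None None] by simp
  hence "(\<lambda>n. total_rate D n * (pmf product_form (D, n) * (f (D, n) * g (D, n)))) summable_on UNIV"
    using K by (intro summable_on_mult_bounded[where b = "total_rate D" and c = K]) auto
  thus L: "L D summable_on UNIV" by (simp add: L_def mult_ac)

  define s where "s j i = infsum (\<lambda>n. pmf product_form (D, n) * (eta_0 j * (RD D j i * (f (D, n + e j) * g (D, n + e i))))) UNIV" for j i
  have s: "((\<lambda>n. pmf product_form (D, n) * (eta_0 j * (RD D j i * (f (D, n + e j) * g (D, n + e i))))) has_sum s j i) UNIV" for j i
    unfolding s_def
    using summable_on_cmult_right[OF summable_on_routing_product[OF f g], of "eta_0 j * RD D j i" D j i]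
    by (intro has_sum_infsum) (simp add: mult_ac)
  have "((\<lambda>n. \<Sum>j\<in>nodes0 D. \<Sum>i\<in>nodes0 D. pmf product_form (D, n) * (eta_0 j * (RD D j i * (f (D, n + e j) * g (D, n + e i)))))
      has_sum (\<Sum>j\<in>nodes0 D. \<Sum>i\<in>nodes0 D. s j i)) UNIV"
    by (intro has_sum_sum_finite s) auto
  hence X_sum: "(X D has_sum (\<Sum>j\<in>nodes0 D. \<Sum>i\<in>nodes0 D. s j i)) UNIV"
    by (simp add: X_def sum_distrib_left mult.assoc)
  thus "X D summable_on UNIV" by (rule has_sum_imp_summable)

  have "((\<lambda>n. pmf product_form (D, n) * (svc n j * (RD D j i * (f (D, n) * g (D, n - e j + e i))))) has_sum s j i) UNIV" for j i
    using product_form_shift[of D j "\<lambda>n. RD D j i * (f (D, n) * g (D, n - e j + e i))" "s j i"] s[of j i] by simp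
  hence "((\<lambda>n. \<Sum>j\<in>nodes0 D. \<Sum>i\<in>nodes0 D. pmf product_form (D, n) * (svc n j * (RD D j i * (f (D, n) * g (D, n - e j + e i)))))
      has_sum (\<Sum>j\<in>nodes0 D. \<Sum>i\<in>nodes0 D. s j i)) UNIV"
    by (intro has_sum_sum_finite) auto
  hence X': "((\<lambda>n. \<Sum>j\<in>nodes0 D. \<Sum>i\<in>nodes0 D. pmf product_form (D, n) * (svc n j * (RD D j i * (f (D, n) * g (D, n - e j + e i)))))
      has_sum infsum (X D) UNIV) UNIV"
    using infsumI[OF X_sum] by simp
  have "Y D n + (\<Sum>j\<in>nodes0 D. \<Sum>i\<in>nodes0 D. pmf product_form (D, n) * (svc n j * (RD D j i * (f (D, n) * g (D, n - e j + e i))))) - L D n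
      = pmf product_form (D, n) * (f (D, n) * QZ lam mu A B RD g (D, n))" for n
  proof -
    have "Y D n = pmf product_form (D, n) * (f (D, n) * (\<Sum>I\<in>UNIV. qY A B D I * g (I, n)))"
      by (simp add: Y_def sum_distrib_left mult_ac)
    moreover have "(\<Sum>j\<in>nodes0 D. \<Sum>i\<in>nodes0 D. pmf product_form (D, n) * (svc n j * (RD D j i * (f (D, n) * g (D, n - e j + e i)))))
        = pmf product_form (D, n) * (f (D, n) * (\<Sum>j\<in>nodes0 D. \<Sum>i\<in>nodes0 D. svc n j * RD D j i * g (D, n - e j + e i)))"
      by (simp add: sum_distrib_left mult_ac)
    moreover have "L D n = pmf product_form (D, n) * (f (D, n) * (total_rate D n * g (D, n)))"
      by (simp add: L_def mult_ac)
    ultimately show ?thesis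
      unfolding QZ_jump_form by (simp only: right_diff_distrib distrib_left)
  qed
  with has_sum_add[OF has_sum_add[OF has_sum_infsum[OF Y] X'] has_sum_cmult_right[OF has_sum_infsum[OF L], of "- 1"]]
  show "((\<lambda>n. pmf product_form (D, n) * (f (D, n) * QZ lam mu A B RD g (D, n)))
           has_sum (infsum (Y D) UNIV + infsum (X D) UNIV - infsum (L D) UNIV)) UNIV"
    by simp
qed

lemma inner_prod_formula:
  assumes f: "square_integrable product_form f" and g: "square_integrable product_form g"
  shows "integrable (measure_pmf product_form) (\<lambda>x. f x * QZ lam mu A B RD g x)"
    and "inner_prod product_form f (QZ lam mu A B RD g) =
     (\<Sum>D\<in>UNIV. \<Sum>\<^sub>\<infinity>n. pmf product_form (D, n) * (\<Sum>I\<in>UNIV. qY A B D I * f (D, n) * g (I, n)))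
   + (\<Sum>D\<in>UNIV. \<Sum>\<^sub>\<infinity>n. pmf product_form (D, n) *
        (\<Sum>j\<in>nodes0 D. \<Sum>i\<in>nodes0 D. eta_0 j * RD D j i * f (D, n + e j) * g (D, n + e i)))
   - (\<Sum>D\<in>UNIV. \<Sum>\<^sub>\<infinity>n. pmf product_form (D, n) * f (D, n) * g (D, n) * total_rate D n)"
proof -
  note sums = has_sum_finite_fibres[where h = "\<lambda>x. pmf product_form x * (f x * QZ lam mu A B RD g x)",
      OF integral_over_queues(4)[OF f g]]
  show "integrable (measure_pmf product_form) (\<lambda>x. f x * QZ lam mu A B RD g x)"
    unfolding integrable_pmf_iff_summable_on using sums by (rule has_sum_imp_summable)
  show "inner_prod product_form f (QZ lam mu A B RD g) =
     (\<Sum>D\<in>UNIV. \<Sum>\<^sub>\<infinity>n. pmf product_form (D, n) * (\<Sum>I\<in>UNIV. qY A B D I * f (D, n) * g (I, n)))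
   + (\<Sum>D\<in>UNIV. \<Sum>\<^sub>\<infinity>n. pmf product_form (D, n) *
        (\<Sum>j\<in>nodes0 D. \<Sum>i\<in>nodes0 D. eta_0 j * RD D j i * f (D, n + e j) * g (D, n + e i)))
   - (\<Sum>D\<in>UNIV. \<Sum>\<^sub>\<infinity>n. pmf product_form (D, n) * f (D, n) * g (D, n) * total_rate D n)"
    unfolding inner_prod_def
    using expectation_eq_has_sum[OF sums] by (simp add: sum.distrib sum_subtractf)
qed

lemma square_integrable_bounded:
  fixes v :: "'j state \<Rightarrow> real"
  assumes "\<And>x. \<bar>v x\<bar> \<le> c"
  shows "square_integrable p v"
  unfolding square_integrable_def
proof (rule integrable_pmf_bounded)
  show "\<bar>(v x)\<^sup>2\<bar> \<le> c\<^sup>2" for x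
    using power_mono[OF assms[of x] abs_ge_zero, of 2] by simp
qed

text \<open>
  Take \<open>f = 1\<close> in the formula. Summing over \<open>j\<close> first, the invariance of \<open>eta_0\<close> under \<open>RD D\<close> and a
  shift back cancel the routing terms against the departures for every \<open>D\<close>; the breakdown terms cancel only
  after summation over \<open>D\<close>, by detailed balance.
\<close>

lemma product_form_generator_zero:
  assumes v: "\<And>x. \<bar>v x\<bar> \<le> c"
  shows "measure_pmf.expectation product_form (QZ lam mu A B RD v) = 0"
proof -
  let ?w = "\<lambda>D n. pmf product_form (D, n)"
  define V where "V D = infsum (\<lambda>n. pmf queues_pmf n * v (D, n)) UNIV" for D
  have sq_v: "square_integrable product_form v" using v by (rule square_integrable_bounded)
  have sq_1: "square_integrable product_form (\<lambda>_. 1)" by (rule square_integrable_bounded[of _ 1]) simp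
  have "integrable (measure_pmf queues_pmf) (\<lambda>n. v (D, n))" for D
    using v by (rule integrable_pmf_bounded)
  hence V: "((\<lambda>n. pmf queues_pmf n * v (D, n)) has_sum V D) UNIV" for D
    unfolding V_def by (simp add: integrable_pmf_iff_summable_on)
  have Y_sum: "((\<lambda>n. ?w D n * (\<Sum>I\<in>UNIV. qY A B D I * v (I, n))) has_sum
      (\<Sum>I\<in>UNIV. pmf breakdown_pmf D * qY A B D I * V I)) UNIV" for D
  proof -
    have "((\<lambda>n. \<Sum>I\<in>UNIV. pmf breakdown_pmf D * qY A B D I * (pmf queues_pmf n * v (I, n))) has_sum
      (\<Sum>I\<in>UNIV. pmf breakdown_pmf D * qY A B D I * V I)) UNIV"
      by (intro has_sum_sum_finite has_sum_cmult_right V) auto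
    thus ?thesis by (simp add: pmf_product_form sum_distrib_left mult_ac)
  qed
  have X_eq_L: "(\<Sum>\<^sub>\<infinity>n. ?w D n * (\<Sum>j\<in>nodes0 D. \<Sum>i\<in>nodes0 D. eta_0 j * RD D j i * 1 * v (D, n + e i)))
      + (\<Sum>I\<in>UNIV. pmf breakdown_pmf D * qY A B D I * V D)
      = (\<Sum>\<^sub>\<infinity>n. ?w D n * 1 * v (D, n) * total_rate D n)" for D
  proof -
    obtain M where M: "\<And>n j. svc n j \<le> M" using svc_bound by blast
    define u where "u i = infsum (\<lambda>n. ?w D n * (svc n i * v (D, n))) UNIV" for i
    have vD: "(\<lambda>n. ?w D n * v (D, n)) summable_on UNIV"
      using summable_on_cmult_right[OF has_sum_imp_summable[OF V[of D]], of "pmf breakdown_pmf D"]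
      by (simp add: pmf_product_form mult_ac)
    have "(\<lambda>n. svc n i * (?w D n * v (D, n))) summable_on UNIV" for i
      using M svc_nonneg by (intro summable_on_mult_bounded[OF vD, of _ M]) auto
    hence u: "((\<lambda>n. ?w D n * (svc n i * v (D, n))) has_sum u i) UNIV" for i
      unfolding u_def by (intro has_sum_infsum) (simp add: mult_ac)
    hence u': "((\<lambda>n. ?w D n * (eta_0 i * v (D, n + e i))) has_sum u i) UNIV" for i
      using product_form_shift[of D i "\<lambda>n. v (D, n)" "u i"] by simp
    have "(\<Sum>j\<in>nodes0 D. \<Sum>i\<in>nodes0 D. eta_0 j * RD D j i * 1 * v (D, n + e i))
        = (\<Sum>i\<in>nodes0 D. eta_0 i * v (D, n + e i))" for n
      by (subst sum.swap) (simp add: eta0_invariant[symmetric] flip: sum_distrib_right)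
    hence X: "((\<lambda>n. ?w D n * (\<Sum>j\<in>nodes0 D. \<Sum>i\<in>nodes0 D. eta_0 j * RD D j i * 1 * v (D, n + e i)))
        has_sum (\<Sum>i\<in>nodes0 D. u i)) UNIV"
      using has_sum_sum_finite[of "nodes0 D", OF _ u'] by (simp add: sum_distrib_left)
    have rate: "total_rate D n = (\<Sum>I\<in>UNIV. qY A B D I) + (\<Sum>i\<in>nodes0 D. svc n i)" for n
      by (simp add: total_rate_def sum_nodes0 departure_rate_def)
    have "((\<lambda>n. (\<Sum>i\<in>nodes0 D. ?w D n * (svc n i * v (D, n)))
         + (\<Sum>I\<in>UNIV. pmf breakdown_pmf D * qY A B D I * (pmf queues_pmf n * v (D, n))))
        has_sum ((\<Sum>i\<in>nodes0 D. u i) + (\<Sum>I\<in>UNIV. pmf breakdown_pmf D * qY A B D I * V D))) UNIV"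
      by (intro has_sum_add has_sum_sum_finite has_sum_cmult_right u V) auto
    moreover have "(\<Sum>i\<in>nodes0 D. ?w D n * (svc n i * v (D, n)))
         + (\<Sum>I\<in>UNIV. pmf breakdown_pmf D * qY A B D I * (pmf queues_pmf n * v (D, n)))
        = ?w D n * 1 * v (D, n) * total_rate D n" for n
      unfolding rate by (simp add: pmf_product_form distrib_left sum_distrib_left mult_ac)
    ultimately have "((\<lambda>n. ?w D n * 1 * v (D, n) * total_rate D n)
        has_sum ((\<Sum>i\<in>nodes0 D. u i) + (\<Sum>I\<in>UNIV. pmf breakdown_pmf D * qY A B D I * V D))) UNIV"
      by simp
    thus ?thesis using infsumI[OF X] by (simp add: infsumI)
  qed
  have "measure_pmf.expectation product_form (QZ lam mu A B RD v)
      = inner_prod product_form (\<lambda>_. 1) (QZ lam mu A B RD v)"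
    by (simp add: inner_prod_def)
  also have "\<dots> = (\<Sum>D\<in>UNIV. \<Sum>I\<in>UNIV. pmf breakdown_pmf D * qY A B D I * V I)
      - (\<Sum>D\<in>UNIV. \<Sum>I\<in>UNIV. pmf breakdown_pmf D * qY A B D I * V D)"
    unfolding inner_prod_formula(2)[OF sq_1 sq_v] X_eq_L[symmetric]
    using infsumI[OF Y_sum] by (simp add: sum.distrib)
  also have "(\<Sum>D\<in>UNIV. \<Sum>I\<in>UNIV. pmf breakdown_pmf D * qY A B D I * V I)
      = (\<Sum>D\<in>UNIV. \<Sum>I\<in>UNIV. pmf breakdown_pmf D * qY A B D I * V D)"
    by (subst sum.swap) (simp add: breakdown_detailed_balance)
  finally show ?thesis by simp
qed

end

section \<open>Identification of the stationary distribution\<close>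

context unreliable_jackson_network
begin

lemma bounded_generator_QZ:
  assumes "unreliable_jackson_process lam mu A B RD P"
  shows "\<exists>K. bounded_generator P (QZ lam mu A B RD) K"
proof -
  obtain K where K: "K \<ge> 0" "\<And>D n. total_rate D n \<le> K" using total_rate_bound by blast
  have "bounded_generator P (QZ lam mu A B RD) K"
  proof
    fix x :: "'j state"
    obtain D n where x: "x = (D, n)" by (cases x)
    have "0 \<le> (\<Sum>I\<in>UNIV. qY A B D I * indicator {x} (I, n))
        + (\<Sum>j\<in>nodes0 D. \<Sum>i\<in>nodes0 D. svc n j * RD D j i * indicator {x} (D, n - e j + e i))"
      by (intro add_nonneg_nonneg sum_nonneg mult_nonneg_nonneg qY_nonneg svc_nonneg RD_nonneg) auto
    thus "- K \<le> QZ lam mu A B RD (indicator {x}) x"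
      using K(2)[of D n] unfolding x QZ_jump_form by simp
  qed (use assms K in \<open>auto simp: unreliable_jackson_process_def\<close>)
  thus ?thesis ..
qed

lemma B_zero_mono:
  assumes "D \<subseteq> I" "B D = 0"
  shows "B I = 0"
proof (cases "D = I")
  case False
  show ?thesis
  proof (rule ccontr)
    assume "B I \<noteq> 0"
    hence "B I > 0" using B_nonneg[of I] by simp
    thus False using B_finite[of D I] assms False by (simp add: psubset_eq)
  qed
qed (use assms in simp)

text \<open>
  If \<open>B D = 0\<close>, then no node of \<open>D\<close> is ever repaired once \<open>D\<close> is broken down. The queue lengths
  there are frozen, and the limit law remembers the initial ones.
\<close>

lemma ergodic_imp_B_pos:
  assumes Z: "unreliable_jackson_process lam mu A B RD P" and erg: "ergodic P"
  shows "B D > 0"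
proof (rule ccontr)
  assume "\<not> B D > 0"
  hence B0: "B D = 0" using B_nonneg[of D] by simp
  hence "D \<noteq> {}" using B_empty by auto
  then obtain j where j: "j \<in> D" by blast
  obtain K where "bounded_generator P (QZ lam mu A B RD) K" using bounded_generator_QZ[OF Z] by blast
  then interpret bounded_generator P "QZ lam mu A B RD" K .
  obtain q where q: "\<And>x y. ((\<lambda>t. pmf (P t x) y) \<longlongrightarrow> pmf q y) at_top"
    using erg by (auto simp: ergodic_def)
  \<comment> \<open>On \<open>S k\<close> the set \<open>D\<close> stays broken down and node \<open>j\<close> keeps its \<open>k\<close> customers.\<close>
  define S where "S k = {x :: 'j state. D \<subseteq> fst x \<and> snd x j = k}" for k :: nat
  have inside: "QZ lam mu A B RD (indicator (S k)) x = 0" if "x \<in> S k" for x k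
  proof -
    obtain D' n where x: "x = (D', n)" by (cases x)
    have D': "D \<subseteq> D'" "j \<in> D'" "n j = k" using that j by (auto simp: S_def x)
    have "qY A B D' H = 0" if "H \<subset> D'" for H
      using B_zero_mono[OF D'(1) B0] that by (auto simp: qY_def)
    moreover have "D \<subseteq> I" if "D' \<subset> I" for I using D' that by auto
    moreover have "e (Some i) j = 0" if "i \<in> - D'" for i using that D' by (auto simp: e_def)
    ultimately show ?thesis
      using D' unfolding x QZ_def QY_def prod.case by (simp add: S_def indicator_def)
  qed
  have q0: "pmf q y = 0" if "y \<notin> S k" for y k
  proof -
    have "(D, \<lambda>_. k) \<in> S k" by (simp add: S_def)
    hence "pmf (P t (D, \<lambda>_. k)) y = 0" if "t \<ge> 0" for t
      using absorbing_if_no_exit_rate[of "S k" "(D, \<lambda>_. k)" t y] inside that \<open>y \<notin> S k\<close> by simp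
    hence "\<forall>\<^sub>F t in at_top. pmf (P t (D, \<lambda>_. k)) y = 0"
      by (intro eventually_mono[OF eventually_ge_at_top[of "0::real"]])
    hence "((\<lambda>t. pmf (P t (D, \<lambda>_. k)) y) \<longlongrightarrow> 0) at_top" by (rule tendsto_eventually)
    thus ?thesis using tendsto_unique[OF _ q[of "(D, \<lambda>_. k)" y]] by simp
  qed
  \<comment> \<open>The limit law lives on both \<open>S 0\<close> and \<open>S 1\<close>, which are disjoint.\<close>
  have "pmf q y = 0" for y
    using q0[of y 0] q0[of y 1] by (cases "snd y j = 0") (auto simp: S_def)
  thus False using set_pmf_not_empty[of q] by (auto simp: set_pmf_eq)
qed

lemma xi_normalization: "lam / xi lam eta D None * xi lam eta D j = eta_0 j"
proof -
  have "(\<Sum>k\<in>nodes0 D. eta_0 k) > 0"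
    by (rule sum_pos) (auto simp: eta0_pos nodes0_def)
  thus ?thesis using lam_pos by (simp add: xi_def eta0_def)
qed

end

lemma (in repairable_jackson_network) stationary_eq_product_form:
  assumes Z: "unreliable_jackson_process lam mu A B RD P"
    and "ergodic P" "stationary_distribution P p"
  shows "p = product_form"
proof -
  obtain K where "bounded_generator P (QZ lam mu A B RD) K" using bounded_generator_QZ[OF Z] by blast
  then interpret bounded_generator P "QZ lam mu A B RD" K .
  obtain q where q: "\<And>x y. ((\<lambda>t. pmf (P t x) y) \<longlongrightarrow> pmf q y) at_top"
    using \<open>ergodic P\<close> by (auto simp: ergodic_def)
  have "stationary_distribution P product_form"
    using product_form_generator_zero by (rule stationary_if_generator_integral_zero)
  hence "product_form = q" using q by (rule ergodic_stationary_unique)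
  moreover have "p = q" using \<open>stationary_distribution P p\<close> q by (rule ergodic_stationary_unique)
  ultimately show ?thesis by simp
qed

section \<open>The bilinear form of the generator\<close>

theorem proposition3p2:
  fixes lam :: real
    and R :: "'j::finite option \<Rightarrow> 'j option \<Rightarrow> real"
    and mu :: "'j \<Rightarrow> nat \<Rightarrow> real"
    and eta :: "'j \<Rightarrow> real"
    and A B :: "'j set \<Rightarrow> real"
    and RD :: "'j set \<Rightarrow> 'j option \<Rightarrow> 'j option \<Rightarrow> real"
    and P :: "real \<Rightarrow> 'j state \<Rightarrow> 'j state pmf"
    and p :: "'j state pmf"
    and f g :: "'j state \<Rightarrow> real"
  assumes "unreliable_jackson_network lam R mu eta A B RD"
    and "unreliable_jackson_process lam mu A B RD P"
    and "ergodic P"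
    and "stationary_distribution P p"
    and "square_integrable p f"
    and "square_integrable p g"
  shows
    "integrable (measure_pmf p) (\<lambda>x. f x * QZ lam mu A B RD g x)
     \<and> (\<forall>D. (\<lambda>n. pmf p (D, n) *
            ((\<Sum>H | H \<subset> D. qY A B D H * f (D, n) * g (H, n))
             + (\<Sum>I | D \<subset> I. qY A B D I * f (D, n) * g (I, n)))) summable_on UNIV)
     \<and> (\<forall>D. (\<lambda>n. pmf p (D, n) * (lam / xi lam eta D None) *
            (\<Sum>j\<in>nodes0 D. \<Sum>i\<in>nodes0 D.
               xi lam eta D j * RD D j i * f (D, n + e j) * g (D, n + e i))) summable_on UNIV)
     \<and> (\<forall>D. (\<lambda>n. pmf p (D, n) * f (D, n) * g (D, n) *
            ((\<Sum>H | H \<subset> D. qY A B D H) + (\<Sum>I | D \<subset> I. qY A B D I)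
             + lam + (\<Sum>j\<in>- D. mu j (n j)))) summable_on UNIV)
     \<and> inner_prod p f (QZ lam mu A B RD g) =
         (\<Sum>D\<in>UNIV. \<Sum>\<^sub>\<infinity>n. pmf p (D, n) *
            ((\<Sum>H | H \<subset> D. qY A B D H * f (D, n) * g (H, n))
             + (\<Sum>I | D \<subset> I. qY A B D I * f (D, n) * g (I, n))))
       + (\<Sum>D\<in>UNIV. \<Sum>\<^sub>\<infinity>n. pmf p (D, n) * (lam / xi lam eta D None) *
            (\<Sum>j\<in>nodes0 D. \<Sum>i\<in>nodes0 D.
               xi lam eta D j * RD D j i * f (D, n + e j) * g (D, n + e i)))
       - (\<Sum>D\<in>UNIV. \<Sum>\<^sub>\<infinity>n. pmf p (D, n) * f (D, n) * g (D, n) *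
            ((\<Sum>H | H \<subset> D. qY A B D H) + (\<Sum>I | D \<subset> I. qY A B D I)
             + lam + (\<Sum>j\<in>- D. mu j (n j))))"
proof -
  interpret unreliable_jackson_network lam R mu eta A B RD by (rule assms(1))
  interpret repairable_jackson_network lam R mu eta A B RD
    by unfold_locales (rule ergodic_imp_B_pos[OF assms(2,3)])
  have p: "p = product_form" using assms(2-4) by (rule stationary_eq_product_form)
  have f: "square_integrable product_form f" and g: "square_integrable product_form g"
    using assms(5,6) by (simp_all add: p)
  have Y: "(\<Sum>H | H \<subset> D. qY A B D H * f (D, n) * g (H, n)) + (\<Sum>I | D \<subset> I. qY A B D I * f (D, n) * g (I, n))
      = (\<Sum>I\<in>UNIV. qY A B D I * f (D, n) * g (I, n))" for D n
    using qY_sum[of A B D "\<lambda>I. f (D, n) * g (I, n)"] by (simp add: mult.assoc)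
  have L: "(\<Sum>H | H \<subset> D. qY A B D H) + (\<Sum>I | D \<subset> I. qY A B D I) + lam + (\<Sum>j\<in>- D. mu j (n j))
      = total_rate D n" for D n
    using qY_sum[of A B D "\<lambda>_. 1"] by (simp add: total_rate_def)
  have X: "w * (lam / xi lam eta D None) *
        (\<Sum>j\<in>nodes0 D. \<Sum>i\<in>nodes0 D. xi lam eta D j * RD D j i * f (D, n + e j) * g (D, n + e i))
      = w * (\<Sum>j\<in>nodes0 D. \<Sum>i\<in>nodes0 D. eta_0 j * RD D j i * f (D, n + e j) * g (D, n + e i))" for w D n
    by (simp only: xi_normalization[of D, symmetric] sum_distrib_left mult.assoc)
  show ?thesis
    unfolding Y L X p using integral_over_queues(1-3)[OF f g] inner_prod_formula[OF f g] by simp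
qed

end
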